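(* The following is provable in $\mathsf{RCA}_0$: for every $k\in\mathbb{N}$, if $G$ is a bounded locally $k$-chromatic graph, then $G$ is $(2k-1)$-chromatic.
   Context: Work in second-order arithmetic, whose number variables range over $\mathbb{N}$ and set variables over subsets of $\mathbb{N}$; finite sequences, functions, graphs, etc. are coded by sets of natural numbers in the standard way. $\mathsf{RCA}_0$ is the subsystem consisting of the basic axioms of Peano arithmetic, induction restricted to $\Sigma^0_1$ formulas, and recursive comprehension (any set definable by both a $\Sigma^0_1$ formula and a $\Pi^0_1$ formula, with set parameters, exists). A graph $G=\langle V,E\rangle$ has vertex set $V\subseteq\mathbb{N}$ and edge set $E$ a set of unordered pairs of elements of $V$. A $k$-coloring of $G$ is a function $\chi:V\to\{0,\dots,k-1\}$ with $\chi(x)\ne\chi(y)$ whenever $(x,y)\in E$; $G$ is $k$-chromatic if it has a $k$-coloring, and locally $k$-chromatic if every finite subgraph of $G$ is $k$-chromatic. $G$ is bounded if there is a function $h:V\to\mathbb{N}$ such that for all $x,y\in V$, $(x,y)\in E$ implies $h(x)\ge y$. *)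

theory Defs
  imports Main
begin

section \<open>The language of second-order arithmetic\<close>

text \<open>
  Two-sorted first-order syntax with de Bruijn indices. Number variables and set variables
  are indexed separately, each index counting only the enclosing binders of its own sort. The only
  set terms are set variables. The primitive connectives are falsity, implication and the two
  universal quantifiers, the logic being classical. As usual, equality of sets is not primitive.
\<close>

datatype trm =
    Var nat
  | Zero
  | One
  | Add trm trm (infixl \<open>\<^bold>+\<close> 75)
  | Mul trm trm (infixl \<open>\<^bold>*\<close> 80)

datatype fm =
    Bot
  | Eq trm trm (infix \<open>\<^bold>=\<close> 70)
  | Less trm trm (infix \<open>\<^bold><\<close> 70)
  | Mem trm nat (infix \<open>\<^bold>\<in>\<close> 70)
  | Imp fm fm (infixr \<open>\<^bold>\<longrightarrow>\<close> 55)
  | All fm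
  | AllS fm

abbreviation Neg :: "fm \<Rightarrow> fm" (\<open>\<^bold>\<not> _\<close> [65] 65) where
  "\<^bold>\<not> p \<equiv> p \<^bold>\<longrightarrow> Bot"

abbreviation And :: "fm \<Rightarrow> fm \<Rightarrow> fm" (infixr \<open>\<^bold>\<and>\<close> 62) where
  "p \<^bold>\<and> q \<equiv> \<^bold>\<not> (p \<^bold>\<longrightarrow> \<^bold>\<not> q)"

abbreviation Or :: "fm \<Rightarrow> fm \<Rightarrow> fm" (infixr \<open>\<^bold>\<or>\<close> 60) where
  "p \<^bold>\<or> q \<equiv> \<^bold>\<not> p \<^bold>\<longrightarrow> q"

abbreviation Iff :: "fm \<Rightarrow> fm \<Rightarrow> fm" (infix \<open>\<^bold>\<longleftrightarrow>\<close> 53) where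
  "p \<^bold>\<longleftrightarrow> q \<equiv> (p \<^bold>\<longrightarrow> q) \<^bold>\<and> (q \<^bold>\<longrightarrow> p)"

abbreviation Ex :: "fm \<Rightarrow> fm" where
  "Ex p \<equiv> \<^bold>\<not> All (\<^bold>\<not> p)"

abbreviation ExS :: "fm \<Rightarrow> fm" where
  "ExS p \<equiv> \<^bold>\<not> AllS (\<^bold>\<not> p)"

abbreviation Leq :: "trm \<Rightarrow> trm \<Rightarrow> fm" (infix \<open>\<^bold>\<le>\<close> 70) where
  "s \<^bold>\<le> t \<equiv> s \<^bold>< t \<^bold>\<or> s \<^bold>= t"


subsection \<open>Simultaneous substitution\<close>

primrec tsubst :: "(nat \<Rightarrow> trm) \<Rightarrow> trm \<Rightarrow> trm" where
  "tsubst \<sigma> (Var i) = \<sigma> i"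
| "tsubst \<sigma> Zero = Zero"
| "tsubst \<sigma> One = One"
| "tsubst \<sigma> (s \<^bold>+ t) = tsubst \<sigma> s \<^bold>+ tsubst \<sigma> t"
| "tsubst \<sigma> (s \<^bold>* t) = tsubst \<sigma> s \<^bold>* tsubst \<sigma> t"

definition tshift :: "trm \<Rightarrow> trm" where
  "tshift = tsubst (\<lambda>i. Var (Suc i))"

definition up :: "(nat \<Rightarrow> trm) \<Rightarrow> nat \<Rightarrow> trm" where
  "up \<sigma> = case_nat (Var 0) (\<lambda>i. tshift (\<sigma> i))"

text \<open>Substitution for number variables; terms contain no set variables, so nothing has to be
  adjusted under a set quantifier.\<close>

primrec nsubst :: "(nat \<Rightarrow> trm) \<Rightarrow> fm \<Rightarrow> fm" where
  "nsubst \<sigma> Bot = Bot"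
| "nsubst \<sigma> (s \<^bold>= t) = (tsubst \<sigma> s \<^bold>= tsubst \<sigma> t)"
| "nsubst \<sigma> (s \<^bold>< t) = (tsubst \<sigma> s \<^bold>< tsubst \<sigma> t)"
| "nsubst \<sigma> (t \<^bold>\<in> X) = (tsubst \<sigma> t \<^bold>\<in> X)"
| "nsubst \<sigma> (p \<^bold>\<longrightarrow> q) = (nsubst \<sigma> p \<^bold>\<longrightarrow> nsubst \<sigma> q)"
| "nsubst \<sigma> (All p) = All (nsubst (up \<sigma>) p)"
| "nsubst \<sigma> (AllS p) = AllS (nsubst \<sigma> p)"

text \<open>Substitution of set variables for set variables.\<close>

primrec ssubst :: "(nat \<Rightarrow> nat) \<Rightarrow> fm \<Rightarrow> fm" where
  "ssubst \<rho> Bot = Bot"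
| "ssubst \<rho> (s \<^bold>= t) = (s \<^bold>= t)"
| "ssubst \<rho> (s \<^bold>< t) = (s \<^bold>< t)"
| "ssubst \<rho> (t \<^bold>\<in> X) = (t \<^bold>\<in> \<rho> X)"
| "ssubst \<rho> (p \<^bold>\<longrightarrow> q) = (ssubst \<rho> p \<^bold>\<longrightarrow> ssubst \<rho> q)"
| "ssubst \<rho> (All p) = All (ssubst \<rho> p)"
| "ssubst \<rho> (AllS p) = AllS (ssubst (case_nat 0 (\<lambda>i. Suc (\<rho> i))) p)"

definition nshift :: "fm \<Rightarrow> fm" where
  "nshift = nsubst (\<lambda>i. Var (Suc i))"

definition sshift :: "fm \<Rightarrow> fm" where
  "sshift = ssubst Suc"

text \<open>Instantiation of the outermost variable, the remaining ones moving down by one.\<close>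

definition ninst :: "trm \<Rightarrow> fm \<Rightarrow> fm" where
  "ninst t = nsubst (case_nat t Var)"

definition sinst :: "nat \<Rightarrow> fm \<Rightarrow> fm" where
  "sinst X = ssubst (case_nat X (\<lambda>i. i))"


section \<open>Provability\<close>

text \<open>
  Classical natural deduction with equality. The formulas in the set \<open>T\<close> are the non-logical
  axioms. They are not shifted by the introduction rules for the quantifiers, so an axiom
  with free variables stands for its universal closure; the hypotheses in \<open>\<Gamma>\<close> are shifted.
\<close>

inductive provable :: "fm set \<Rightarrow> fm list \<Rightarrow> fm \<Rightarrow> bool" (\<open>_; _ \<turnstile> _\<close> [50, 50, 50] 50)
  for T :: "fm set" where
  Axiom: "p \<in> T \<Longrightarrow> T; \<Gamma> \<turnstile> p"
| Hyp: "p \<in> set \<Gamma> \<Longrightarrow> T; \<Gamma> \<turnstile> p"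
| ImpI: "T; p # \<Gamma> \<turnstile> q \<Longrightarrow> T; \<Gamma> \<turnstile> p \<^bold>\<longrightarrow> q"
| ImpE: "T; \<Gamma> \<turnstile> p \<^bold>\<longrightarrow> q \<Longrightarrow> T; \<Gamma> \<turnstile> p \<Longrightarrow> T; \<Gamma> \<turnstile> q"
| Contr: "T; (\<^bold>\<not> p) # \<Gamma> \<turnstile> Bot \<Longrightarrow> T; \<Gamma> \<turnstile> p"
| AllI: "T; map nshift \<Gamma> \<turnstile> p \<Longrightarrow> T; \<Gamma> \<turnstile> All p"
| AllE: "T; \<Gamma> \<turnstile> All p \<Longrightarrow> T; \<Gamma> \<turnstile> ninst t p"
| AllSI: "T; map sshift \<Gamma> \<turnstile> p \<Longrightarrow> T; \<Gamma> \<turnstile> AllS p"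
| AllSE: "T; \<Gamma> \<turnstile> AllS p \<Longrightarrow> T; \<Gamma> \<turnstile> sinst X p"
| EqRefl: "T; \<Gamma> \<turnstile> t \<^bold>= t"
| EqSubst: "T; \<Gamma> \<turnstile> s \<^bold>= t \<Longrightarrow> T; \<Gamma> \<turnstile> ninst s p \<Longrightarrow> T; \<Gamma> \<turnstile> ninst t p"


section \<open>The axioms of \<open>RCA\<^sub>0\<close>\<close>

text \<open>
  In the bounded quantifiers the bound is shifted, i.e. the quantified variable does not
  occur in it.
\<close>

inductive bounded_fm :: "fm \<Rightarrow> bool" where
  "bounded_fm Bot"
| "bounded_fm (s \<^bold>= t)"
| "bounded_fm (s \<^bold>< t)"
| "bounded_fm (t \<^bold>\<in> X)"
| "bounded_fm p \<Longrightarrow> bounded_fm q \<Longrightarrow> bounded_fm (p \<^bold>\<longrightarrow> q)"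
| "bounded_fm p \<Longrightarrow> bounded_fm (All (Var 0 \<^bold>< tshift t \<^bold>\<longrightarrow> p))"
| "bounded_fm p \<Longrightarrow> bounded_fm (Ex (Var 0 \<^bold>< tshift t \<^bold>\<and> p))"

definition Sigma01 :: "fm set" where
  "Sigma01 = {Ex p | p. bounded_fm p}"

definition Pi01 :: "fm set" where
  "Pi01 = {All p | p. bounded_fm p}"

definition basic_axioms :: "fm set" where
  "basic_axioms = {
    \<^bold>\<not> (Var 0 \<^bold>+ One \<^bold>= Zero),
    Var 0 \<^bold>+ One \<^bold>= Var 1 \<^bold>+ One \<^bold>\<longrightarrow> Var 0 \<^bold>= Var 1,
    Var 0 \<^bold>+ Zero \<^bold>= Var 0,
    Var 0 \<^bold>+ (Var 1 \<^bold>+ One) \<^bold>= (Var 0 \<^bold>+ Var 1) \<^bold>+ One,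
    Var 0 \<^bold>* Zero \<^bold>= Zero,
    Var 0 \<^bold>* (Var 1 \<^bold>+ One) \<^bold>= (Var 0 \<^bold>* Var 1) \<^bold>+ Var 0,
    \<^bold>\<not> (Var 0 \<^bold>< Zero),
    Var 0 \<^bold>< Var 1 \<^bold>+ One \<^bold>\<longleftrightarrow> (Var 0 \<^bold>< Var 1 \<^bold>\<or> Var 0 \<^bold>= Var 1)}"

text \<open>
  In the schemes below, variable \<open>0\<close> of \<open>p\<close> is the induction or comprehension variable and all
  other free variables of \<open>p\<close> are parameters.
\<close>

definition subst_succ :: "fm \<Rightarrow> fm" where
  "subst_succ = nsubst (case_nat (Var 0 \<^bold>+ One) (\<lambda>i. Var (Suc i)))"

definition induction :: "fm \<Rightarrow> fm" where
  "induction p = (ninst Zero p \<^bold>\<and> All (p \<^bold>\<longrightarrow> subst_succ p) \<^bold>\<longrightarrow> All p)"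

text \<open>Shifting \<open>p\<close> expresses that the comprehended set does not occur in \<open>p\<close>.\<close>

definition comprehension :: "fm \<Rightarrow> fm \<Rightarrow> fm" where
  "comprehension p q =
     (All (p \<^bold>\<longleftrightarrow> q) \<^bold>\<longrightarrow> ExS (All (Var 0 \<^bold>\<in> 0 \<^bold>\<longleftrightarrow> sshift p)))"

definition RCA0 :: "fm set" where
  "RCA0 = basic_axioms
     \<union> {induction p | p. p \<in> Sigma01}
     \<union> {comprehension p q | p q. p \<in> Sigma01 \<and> q \<in> Pi01}"


section \<open>Graphs and colorings\<close>

text \<open>
  The following are formulas whose arguments are set variables (given by their indices) and
  terms. Inside them, terms are used under further number quantifiers only in shifted form, and set
  indices are increased under set quantifiers.

  Ordered pairs are coded by \<open>(s, t) = (s + t)\<^sup>2 + s\<close>, which is injective but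
  not onto.
\<close>

definition pair :: "trm \<Rightarrow> trm \<Rightarrow> trm" where
  "pair s t = (s \<^bold>+ t) \<^bold>* (s \<^bold>+ t) \<^bold>+ s"

definition subset :: "nat \<Rightarrow> nat \<Rightarrow> fm" where
  "subset X Y = All (Var 0 \<^bold>\<in> X \<^bold>\<longrightarrow> Var 0 \<^bold>\<in> Y)"

text \<open>As usual in \<open>RCA\<^sub>0\<close>, a set is finite if it is bounded above.\<close>

definition finite_set :: "nat \<Rightarrow> fm" where
  "finite_set X = Ex (All (Var 0 \<^bold>\<in> X \<^bold>\<longrightarrow> Var 0 \<^bold>< Var 1))"

text \<open>\<open>F\<close> is (the graph of) a function from \<open>X\<close> to the natural numbers.\<close>

definition function_on :: "nat \<Rightarrow> nat \<Rightarrow> fm" where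
  "function_on F X =
     (All (Var 0 \<^bold>\<in> F \<^bold>\<longrightarrow> Ex (Ex (Var 1 \<^bold>\<in> X \<^bold>\<and> Var 2 \<^bold>= pair (Var 1) (Var 0))))
      \<^bold>\<and> All (Var 0 \<^bold>\<in> X \<^bold>\<longrightarrow> Ex (pair (Var 1) (Var 0) \<^bold>\<in> F))
      \<^bold>\<and> All (All (All (pair (Var 2) (Var 1) \<^bold>\<in> F \<^bold>\<and> pair (Var 2) (Var 0) \<^bold>\<in> F
           \<^bold>\<longrightarrow> Var 1 \<^bold>= Var 0))))"

text \<open>
  A set of unordered pairs is represented by the symmetric irreflexive set of ordered pairs:
  \<open>E\<close> contains both \<open>(x, y)\<close> and \<open>(y, x)\<close> for every edge \<open>{x, y}\<close>, where \<open>x \<noteq> y\<close>.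
\<close>

definition graph :: "nat \<Rightarrow> nat \<Rightarrow> fm" where
  "graph V E =
     All (Var 0 \<^bold>\<in> E \<^bold>\<longrightarrow>
       Ex (Ex (Var 1 \<^bold>\<in> V \<^bold>\<and> Var 0 \<^bold>\<in> V \<^bold>\<and> \<^bold>\<not> (Var 1 \<^bold>= Var 0)
               \<^bold>\<and> Var 2 \<^bold>= pair (Var 1) (Var 0) \<^bold>\<and> pair (Var 0) (Var 1) \<^bold>\<in> E)))"

definition subgraph :: "nat \<Rightarrow> nat \<Rightarrow> nat \<Rightarrow> nat \<Rightarrow> fm" where
  "subgraph V' E' V E = (graph V' E' \<^bold>\<and> subset V' V \<^bold>\<and> subset E' E)"

definition coloring :: "nat \<Rightarrow> nat \<Rightarrow> nat \<Rightarrow> trm \<Rightarrow> fm" where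
  "coloring C V E k =
     (function_on C V
      \<^bold>\<and> All (All (pair (Var 1) (Var 0) \<^bold>\<in> C \<^bold>\<longrightarrow> Var 0 \<^bold>< tshift (tshift k)))
      \<^bold>\<and> All (All (pair (Var 1) (Var 0) \<^bold>\<in> E \<^bold>\<longrightarrow>
           All (All (pair (Var 3) (Var 1) \<^bold>\<in> C \<^bold>\<and> pair (Var 2) (Var 0) \<^bold>\<in> C
             \<^bold>\<longrightarrow> \<^bold>\<not> (Var 1 \<^bold>= Var 0))))))"

definition chromatic :: "nat \<Rightarrow> nat \<Rightarrow> trm \<Rightarrow> fm" where
  "chromatic V E k = ExS (coloring 0 (Suc V) (Suc E) k)"

definition locally_chromatic :: "nat \<Rightarrow> nat \<Rightarrow> trm \<Rightarrow> fm" where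
  "locally_chromatic V E k =
     AllS (AllS (subgraph 1 0 (Suc (Suc V)) (Suc (Suc E)) \<^bold>\<and> finite_set 1
       \<^bold>\<longrightarrow> chromatic 1 0 k))"

definition bounded_graph :: "nat \<Rightarrow> nat \<Rightarrow> fm" where
  "bounded_graph V E =
     ExS (function_on 0 (Suc V)
       \<^bold>\<and> All (All (Var 1 \<^bold>\<in> Suc V \<^bold>\<and> Var 0 \<^bold>\<in> Suc V \<^bold>\<and> pair (Var 1) (Var 0) \<^bold>\<in> Suc E
           \<^bold>\<longrightarrow> All (pair (Var 2) (Var 0) \<^bold>\<in> 0 \<^bold>\<longrightarrow> Var 1 \<^bold>\<le> Var 0))))"

text \<open>\<open>m = 2 * k - 1\<close>; for \<open>k = 0\<close>, where there are no colors \<open>0, \<dots>, 2 * k - 2\<close>, this is \<open>m = 0\<close>.\<close>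

definition twice_minus_one :: "trm \<Rightarrow> trm \<Rightarrow> fm" where
  "twice_minus_one m k =
     (m \<^bold>+ One \<^bold>= (One \<^bold>+ One) \<^bold>* k \<^bold>\<or> k \<^bold>= Zero \<^bold>\<and> m \<^bold>= Zero)"

end

theory Submission
  imports Defs "HOL-Library.Countable"
begin

text \<open>
  By a Henkin construction, a sentence that is not provable fails in some model of \<open>RCA\<^sub>0\<close>, so
  it suffices to argue in an arbitrary, possibly nonstandard model. There the bound \<open>h\<close> yields cut
  points \<open>0 = a\<^sub>0 < a\<^sub>1 < \<dots>\<close> so far apart that a path of length two starting below \<open>a\<^sub>n\<close> stays
  below \<open>a\<^sub>n\<^sub>+\<^sub>1\<close>. Finite \<open>k\<close>-colorings of longer and longer initial segments are chosen as least codes,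
  and the blocks \<open>[a\<^sub>n, a\<^sub>n\<^sub>+\<^sub>1)\<close> use alternately two palettes of \<open>k\<close> colors that share the
  color \<open>0\<close>. The only conflicts are between vertices of color \<open>0\<close> in neighboring blocks. They vanish
  if a vertex \<open>x\<close> of color \<open>0\<close> with a neighbor in the previous block instead gets the color which the
  coloring of the previous block assigns to \<open>x\<close>, in the palette of that block.
\<close>


section \<open>Substitution\<close>

text \<open>The colorings of different initial segments need not agree: passing to a limit of finite
  colorings would be a compactness argument, which \<open>RCA0\<close> does not supply. Taking least
  codes makes the finite colorings canonical, so that no choice is involved. The number 2k - 1
  counts two palettes of k colors with one color shared.

  The change of color creates no new conflict. The changed vertices of a block all have color 0 in
  one proper coloring, so no two of them are adjacent. Against the previous block they are compared
  within the coloring used there. None of them has a neighbor in the next block, since this would be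
  the end of a path of length two that starts in an earlier block and reaches too far.

  Only Sigma01 induction and Delta01 comprehension are at hand. Hence the sequence of cut points is
  never formed, only the set of its values, by a greedy recursion, and notions are kept bounded with
  at most one unbounded number quantifier in front.\<close>

lemma tsubst_tsubst: "tsubst \<tau> (tsubst \<sigma> t) = tsubst (\<lambda>i. tsubst \<tau> (\<sigma> i)) t"
  by (induction t) auto

lemma tsubst_Var [simp]: "tsubst Var t = t"
  by (induction t) auto

lemma tsubst_tshift: "tsubst \<tau> (tshift t) = tsubst (\<lambda>i. \<tau> (Suc i)) t"
  by (simp add: tshift_def tsubst_tsubst)

lemma tshift_tsubst: "tshift (tsubst \<sigma> t) = tsubst (\<lambda>i. tshift (\<sigma> i)) t"
  by (simp add: tshift_def tsubst_tsubst)

lemma tshift_simps [simp]: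
  "tshift (Var i) = Var (Suc i)" "tshift Zero = Zero" "tshift One = One"
  "tshift (s \<^bold>+ t) = tshift s \<^bold>+ tshift t" "tshift (s \<^bold>* t) = tshift s \<^bold>* tshift t"
  by (simp_all add: tshift_def)

lemma up_simps [simp]: "up \<sigma> 0 = Var 0" "up \<sigma> (Suc i) = tshift (\<sigma> i)"
  by (simp_all add: up_def)

lemma tsubst_up_tshift: "tsubst (up \<tau>) (tshift t) = tshift (tsubst \<tau> t)"
  by (simp add: tsubst_tshift tshift_tsubst)

lemma up_Var [simp]: "up Var = Var"
  by (rule ext, case_tac x) auto

lemma nsubst_Var [simp]: "nsubst Var p = p"
  by (induction p) auto

lemma nsubst_nsubst: "nsubst \<tau> (nsubst \<sigma> p) = nsubst (\<lambda>i. tsubst \<tau> (\<sigma> i)) p"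
proof (induction p arbitrary: \<sigma> \<tau>)
  case (All p)
  have "(\<lambda>i. tsubst (up \<tau>) (up \<sigma> i)) = up (\<lambda>i. tsubst \<tau> (\<sigma> i))"
    by (rule ext, case_tac i) (auto simp: tsubst_up_tshift)
  then show ?case by (simp add: All)
qed (auto simp: tsubst_tsubst)

lemma case_nat_0_Suc: "case_nat 0 (\<lambda>i. Suc i) = (\<lambda>i. i)"
  by (rule ext, case_tac i) auto

lemma ssubst_id [simp]: "ssubst (\<lambda>i. i) p = p"
  by (induction p) (auto simp: case_nat_0_Suc)

lemma ssubst_ssubst: "ssubst \<tau> (ssubst \<sigma> p) = ssubst (\<lambda>i. \<tau> (\<sigma> i)) p"
proof (induction p arbitrary: \<sigma> \<tau>)
  case (AllS p)
  have "(\<lambda>i. case_nat 0 (\<lambda>i. Suc (\<tau> i)) (case_nat 0 (\<lambda>i. Suc (\<sigma> i)) i))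
      = case_nat 0 (\<lambda>i. Suc (\<tau> (\<sigma> i)))"
    by (rule ext, case_tac i) auto
  then show ?case by (simp add: AllS)
qed auto

lemma nsubst_ssubst: "nsubst \<sigma> (ssubst \<rho> p) = ssubst \<rho> (nsubst \<sigma> p)"
  by (induction p arbitrary: \<sigma> \<rho>) auto

lemma ninst_nsubst_up: "ninst t (nsubst (up \<sigma>) p) = nsubst (case_nat t \<sigma>) p"
proof -
  have "(\<lambda>i. tsubst (case_nat t Var) (up \<sigma> i)) = case_nat t \<sigma>"
    by (rule ext, case_tac i) (auto simp: tsubst_tshift)
  then show ?thesis by (simp add: ninst_def nsubst_nsubst)
qed

lemma sinst_ssubst_up:
  "sinst X (ssubst (case_nat 0 (\<lambda>i. Suc (\<rho> i))) p) = ssubst (case_nat X \<rho>) p"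
proof -
  have "(\<lambda>i. case_nat X (\<lambda>i. i) (case_nat 0 (\<lambda>i. Suc (\<rho> i)) i)) = case_nat X \<rho>"
    by (rule ext, case_tac i) auto
  then show ?thesis by (simp add: sinst_def ssubst_ssubst)
qed

section \<open>Finite support of formulas and freshness\<close>

lemma tsubst_finite: "\<exists>N. \<forall>\<sigma> \<tau>. (\<forall>i<N. \<sigma> i = \<tau> i) \<longrightarrow> tsubst \<sigma> t = tsubst \<tau> t"
proof (induction t)
  case (Var i)
  then show ?case by (intro exI[of _ "Suc i"]) auto
next
  case (Add s t)
  then obtain M N where "\<forall>\<sigma> \<tau>. (\<forall>i<M. \<sigma> i = \<tau> i) \<longrightarrow> tsubst \<sigma> s = tsubst \<tau> s"
    "\<forall>\<sigma> \<tau>. (\<forall>i<N. \<sigma> i = \<tau> i) \<longrightarrow> tsubst \<sigma> t = tsubst \<tau> t" by blast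
  then show ?case by (intro exI[of _ "M + N"]) simp
next
  case (Mul s t)
  then obtain M N where "\<forall>\<sigma> \<tau>. (\<forall>i<M. \<sigma> i = \<tau> i) \<longrightarrow> tsubst \<sigma> s = tsubst \<tau> s"
    "\<forall>\<sigma> \<tau>. (\<forall>i<N. \<sigma> i = \<tau> i) \<longrightarrow> tsubst \<sigma> t = tsubst \<tau> t" by blast
  then show ?case by (intro exI[of _ "M + N"]) simp
qed auto

text \<open>Freshness is phrased through the effect of substitutions instead of sets of free
  variables, because this effect is the form in which it gets used.\<close>

definition nvars_below :: "nat \<Rightarrow> fm \<Rightarrow> bool" where
  "nvars_below N p \<longleftrightarrow> (\<forall>\<sigma> \<tau>. (\<forall>i<N. \<sigma> i = \<tau> i) \<longrightarrow> nsubst \<sigma> p = nsubst \<tau> p)"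

definition svars_below :: "nat \<Rightarrow> fm \<Rightarrow> bool" where
  "svars_below N p \<longleftrightarrow> (\<forall>\<sigma> \<tau>. (\<forall>i<N. \<sigma> i = \<tau> i) \<longrightarrow> ssubst \<sigma> p = ssubst \<tau> p)"

lemma nvars_below_mono: "nvars_below M p \<Longrightarrow> M \<le> N \<Longrightarrow> nvars_below N p"
  unfolding nvars_below_def by (meson order_less_le_trans)

lemma svars_below_mono: "svars_below M p \<Longrightarrow> M \<le> N \<Longrightarrow> svars_below N p"
  unfolding svars_below_def by (meson order_less_le_trans)

lemma ex_nvars_below: "\<exists>N. nvars_below N p"
proof (induction p)
  case (Eq s t)
  obtain M N where "\<forall>\<sigma> \<tau>. (\<forall>i<M. \<sigma> i = \<tau> i) \<longrightarrow> tsubst \<sigma> s = tsubst \<tau> s"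
    "\<forall>\<sigma> \<tau>. (\<forall>i<N. \<sigma> i = \<tau> i) \<longrightarrow> tsubst \<sigma> t = tsubst \<tau> t" using tsubst_finite by metis
  then show ?case by (intro exI[of _ "M + N"]) (simp add: nvars_below_def)
next
  case (Less s t)
  obtain M N where "\<forall>\<sigma> \<tau>. (\<forall>i<M. \<sigma> i = \<tau> i) \<longrightarrow> tsubst \<sigma> s = tsubst \<tau> s"
    "\<forall>\<sigma> \<tau>. (\<forall>i<N. \<sigma> i = \<tau> i) \<longrightarrow> tsubst \<sigma> t = tsubst \<tau> t" using tsubst_finite by metis
  then show ?case by (intro exI[of _ "M + N"]) (simp add: nvars_below_def)
next
  case (Mem t X)
  obtain N where "\<forall>\<sigma> \<tau>. (\<forall>i<N. \<sigma> i = \<tau> i) \<longrightarrow> tsubst \<sigma> t = tsubst \<tau> t"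
    using tsubst_finite by metis
  then show ?case by (intro exI[of _ N]) (simp add: nvars_below_def)
next
  case (Imp p q)
  then obtain M N where "nvars_below M p" "nvars_below N q" by blast
  then have "nvars_below (M + N) p" "nvars_below (M + N) q"
    by (auto elim: nvars_below_mono)
  then have "nvars_below (M + N) (p \<^bold>\<longrightarrow> q)" by (simp add: nvars_below_def)
  then show ?case ..
next
  case (All p)
  then obtain N where N: "nvars_below N p" by blast
  have "nvars_below N (All p)"
    unfolding nvars_below_def
  proof (intro allI impI)
    fix \<sigma> \<tau> :: "nat \<Rightarrow> trm" assume "\<forall>i<N. \<sigma> i = \<tau> i"
    then have "\<forall>i<N. up \<sigma> i = up \<tau> i" by (auto simp: up_def split: nat.split)
    then show "nsubst \<sigma> (All p) = nsubst \<tau> (All p)" using N by (simp add: nvars_below_def)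
  qed
  then show ?case ..
qed (auto simp: nvars_below_def)

lemma ex_svars_below: "\<exists>N. svars_below N p"
proof (induction p)
  case (Mem t X)
  then show ?case by (intro exI[of _ "Suc X"]) (simp add: svars_below_def)
next
  case (Imp p q)
  then obtain M N where "svars_below M p" "svars_below N q" by blast
  then have "svars_below (M + N) p" "svars_below (M + N) q"
    by (auto elim: svars_below_mono)
  then have "svars_below (M + N) (p \<^bold>\<longrightarrow> q)" by (simp add: svars_below_def)
  then show ?case ..
next
  case (AllS p)
  then obtain N where N: "svars_below N p" by blast
  have "svars_below N (AllS p)"
    unfolding svars_below_def
  proof (intro allI impI)
    fix \<sigma> \<tau> :: "nat \<Rightarrow> nat" assume "\<forall>i<N. \<sigma> i = \<tau> i"
    then have "\<forall>i<N. case_nat 0 (\<lambda>i. Suc (\<sigma> i)) i = case_nat 0 (\<lambda>i. Suc (\<tau> i)) i"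
      by (auto split: nat.split)
    then show "ssubst \<sigma> (AllS p) = ssubst \<tau> (AllS p)"
      using N unfolding svars_below_def ssubst.simps by blast
  qed
  then show ?case ..
qed (auto simp: svars_below_def)


section \<open>Derivations\<close>

lemma weaken: "T; \<Gamma> \<turnstile> p \<Longrightarrow> set \<Gamma> \<subseteq> set \<Delta> \<Longrightarrow> T; \<Delta> \<turnstile> p"
proof (induction arbitrary: \<Delta> rule: provable.induct)
  case (ImpI p \<Gamma> q)
  then show ?case by (auto intro!: provable.ImpI[OF ImpI.IH])
next
  case (Contr p \<Gamma>)
  then show ?case by (auto intro!: provable.Contr[OF Contr.IH])
next
  case (AllI \<Gamma> p)
  then show ?case by (intro provable.AllI[OF AllI.IH]) (simp add: image_mono)
next
  case (AllSI \<Gamma> p)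
  then show ?case by (intro provable.AllSI[OF AllSI.IH]) (simp add: image_mono)
next
  case (ImpE \<Gamma> p q)
  then show ?case by (blast intro: provable.ImpE)
next
  case (EqSubst \<Gamma> s t p)
  then show ?case by (blast intro: provable.EqSubst)
qed (simp_all add: provable.Axiom provable.Hyp provable.AllE provable.AllSE provable.EqRefl
    subset_iff)

lemma BotE: "T; \<Gamma> \<turnstile> Bot \<Longrightarrow> T; \<Gamma> \<turnstile> p"
  by (rule Contr) (erule weaken, auto)

lemma NegI: "T; p # \<Gamma> \<turnstile> Bot \<Longrightarrow> T; \<Gamma> \<turnstile> \<^bold>\<not> p"
  by (rule ImpI)

lemma HypMP: "p \<in> set \<Gamma> \<Longrightarrow> (p \<^bold>\<longrightarrow> q) \<in> set \<Gamma> \<Longrightarrow> T; \<Gamma> \<turnstile> q"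
  by (rule ImpE[OF Hyp Hyp])

lemma cut: "T; \<Gamma> \<turnstile> p \<Longrightarrow> T; p # \<Gamma> \<turnstile> q \<Longrightarrow> T; \<Gamma> \<turnstile> q"
  by (rule ImpE[OF ImpI])

section \<open>Closure of provability under substitution\<close>

lemma provable_nsubst_closed:
  assumes "T; [] \<turnstile> p" shows "T; [] \<turnstile> nsubst \<sigma> p"
proof -
  \<comment> \<open>Generalizing and instantiating replaces one variable. Repetition along a list
    replaces any finite prefix of the variables, and \<open>p\<close> depends on a finite prefix
    only.\<close>
  have *: "T; [] \<turnstile> nsubst (\<lambda>i. if i < length ts then ts ! i else Var (i - length ts)) p"
    if "T; [] \<turnstile> p" for ts p
    using that
  proof (induction ts arbitrary: p)
    case (Cons t ts)
    let ?\<sigma> = "\<lambda>i. if i < length ts then ts ! i else Var (i - length ts)"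
    have "T; [] \<turnstile> All p" using Cons.prems by (auto intro: AllI)
    from Cons.IH[OF this] have "T; [] \<turnstile> ninst t (nsubst (up ?\<sigma>) p)"
      by (auto intro: AllE)
    moreover have "case_nat t ?\<sigma> =
        (\<lambda>i. if i < length (t # ts) then (t # ts) ! i else Var (i - length (t # ts)))"
      by (rule ext, case_tac i) auto
    ultimately show ?case by (simp only: ninst_nsubst_up)
  qed simp
  obtain N where "nvars_below N p" using ex_nvars_below by blast
  then have "nsubst \<sigma> p = nsubst (\<lambda>i. if i < length (map \<sigma> [0..<N]) then map \<sigma> [0..<N] ! i
      else Var (i - length (map \<sigma> [0..<N]))) p"
    by (auto simp: nvars_below_def)
  then show ?thesis using *[OF assms] by metis
qed

lemma provable_ssubst_closed:
  assumes "T; [] \<turnstile> p" shows "T; [] \<turnstile> ssubst \<sigma> p"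
proof -
  have *: "T; [] \<turnstile> ssubst (\<lambda>i. if i < length ts then ts ! i else i - length ts) p"
    if "T; [] \<turnstile> p" for ts p
    using that
  proof (induction ts arbitrary: p)
    case (Cons t ts)
    let ?\<sigma> = "\<lambda>i. if i < length ts then ts ! i else i - length ts"
    have "T; [] \<turnstile> AllS p" using Cons.prems by (auto intro: AllSI)
    from Cons.IH[OF this] have "T; [] \<turnstile> sinst t (ssubst (case_nat 0 (\<lambda>i. Suc (?\<sigma> i))) p)"
      by (auto intro: AllSE)
    moreover have "case_nat t ?\<sigma> =
        (\<lambda>i. if i < length (t # ts) then (t # ts) ! i else i - length (t # ts))"
      by (rule ext, case_tac i) auto
    ultimately show ?case by (simp only: sinst_ssubst_up)
  qed simp
  obtain N where "svars_below N p" using ex_svars_below by blast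
  then have "ssubst \<sigma> p = ssubst (\<lambda>i. if i < length (map \<sigma> [0..<N]) then map \<sigma> [0..<N] ! i
      else i - length (map \<sigma> [0..<N])) p"
    by (auto simp: svars_below_def)
  then show ?thesis using *[OF assms] by metis
qed

lemma provable_foldr_Imp: "T; [] \<turnstile> foldr Imp \<Gamma> p \<longleftrightarrow> T; rev \<Gamma> \<turnstile> p"
proof -
  have "T; \<Delta> \<turnstile> foldr Imp \<Gamma> p \<longleftrightarrow> T; rev \<Gamma> @ \<Delta> \<turnstile> p" for \<Delta>
  proof (induction \<Gamma> arbitrary: \<Delta>)
    case (Cons q \<Gamma>)
    have "T; \<Delta> \<turnstile> q \<^bold>\<longrightarrow> r \<longleftrightarrow> T; q # \<Delta> \<turnstile> r" for r
    proof
      assume "T; \<Delta> \<turnstile> q \<^bold>\<longrightarrow> r"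
      then have "T; q # \<Delta> \<turnstile> q \<^bold>\<longrightarrow> r" by (rule weaken) auto
      then show "T; q # \<Delta> \<turnstile> r" by (rule ImpE) (simp add: Hyp)
    qed (rule ImpI)
    then show ?case using Cons by simp
  qed simp
  from this[of "[]"] show ?thesis by simp
qed

lemma nsubst_foldr_Imp: "nsubst \<sigma> (foldr Imp \<Gamma> p) = foldr Imp (map (nsubst \<sigma>) \<Gamma>) (nsubst \<sigma> p)"
  by (induction \<Gamma>) auto

lemma ssubst_foldr_Imp: "ssubst \<sigma> (foldr Imp \<Gamma> p) = foldr Imp (map (ssubst \<sigma>) \<Gamma>) (ssubst \<sigma> p)"
  by (induction \<Gamma>) auto

text \<open>Discharging the hypotheses into implications reduces this to the case of an empty
  context.\<close>

lemma provable_nsubst: "T; \<Gamma> \<turnstile> p \<Longrightarrow> T; map (nsubst \<sigma>) \<Gamma> \<turnstile> nsubst \<sigma> p"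
  using provable_nsubst_closed[of T "foldr Imp (rev \<Gamma>) p" \<sigma>]
  by (simp add: provable_foldr_Imp nsubst_foldr_Imp rev_map[symmetric])

lemma provable_ssubst: "T; \<Gamma> \<turnstile> p \<Longrightarrow> T; map (ssubst \<sigma>) \<Gamma> \<turnstile> ssubst \<sigma> p"
  using provable_ssubst_closed[of T "foldr Imp (rev \<Gamma>) p" \<sigma>]
  by (simp add: provable_foldr_Imp ssubst_foldr_Imp rev_map[symmetric])

text \<open>Renaming \<open>v\<close> to index 0 while moving all other variables up turns the
  derivation for the fresh \<open>v\<close> into one with shifted hypotheses, as \<open>AllI\<close>
  demands.\<close>

lemma AllI_fresh:
  assumes "T; \<Gamma> \<turnstile> ninst (Var v) p" "\<forall>q\<in>set \<Gamma>. nvars_below v q" "nvars_below v p"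
  shows "T; \<Gamma> \<turnstile> All p"
proof -
  let ?\<sigma> = "\<lambda>i. if i = v then Var 0 else Var (Suc i)"
  have "map (nsubst ?\<sigma>) \<Gamma> = map nshift \<Gamma>"
    using assms(2) by (auto simp: nvars_below_def nshift_def)
  moreover have "nsubst ?\<sigma> (ninst (Var v) p) = p"
  proof -
    have "nsubst (\<lambda>i. tsubst ?\<sigma> (case_nat (Var v) Var i)) p = nsubst Var p"
      using assms(3)[unfolded nvars_below_def, rule_format,
          of "\<lambda>i. tsubst ?\<sigma> (case_nat (Var v) Var i)" Var]
      by (auto split: nat.split)
    then show ?thesis by (simp add: ninst_def nsubst_nsubst)
  qed
  ultimately have "T; map nshift \<Gamma> \<turnstile> p" using provable_nsubst[OF assms(1), of ?\<sigma>] by metis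
  then show ?thesis by (rule AllI)
qed

lemma AllSI_fresh:
  assumes "T; \<Gamma> \<turnstile> sinst v p" "\<forall>q\<in>set \<Gamma>. svars_below v q" "svars_below v p"
  shows "T; \<Gamma> \<turnstile> AllS p"
proof -
  let ?\<sigma> = "\<lambda>i. if i = v then 0 else Suc i"
  have "map (ssubst ?\<sigma>) \<Gamma> = map sshift \<Gamma>"
    using assms(2) by (auto simp: svars_below_def sshift_def)
  moreover have "ssubst ?\<sigma> (sinst v p) = p"
  proof -
    have "ssubst (\<lambda>i. ?\<sigma> (case_nat v (\<lambda>i. i) i)) p = ssubst (\<lambda>i. i) p"
      using assms(3)[unfolded svars_below_def, rule_format,
          of "\<lambda>i. ?\<sigma> (case_nat v (\<lambda>i. i) i)" "\<lambda>i. i"]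
      by (auto split: nat.split)
    then show ?thesis by (simp add: sinst_def ssubst_ssubst)
  qed
  ultimately have "T; map sshift \<Gamma> \<turnstile> p" using provable_ssubst[OF assms(1), of ?\<sigma>] by metis
  then show ?thesis by (rule AllSI)
qed


section \<open>Henkin sets\<close>

instance trm :: countable by countable_datatype
instance fm :: countable by countable_datatype

definition henkin :: "fm set \<Rightarrow> fm set \<Rightarrow> bool" where
  "henkin T H \<longleftrightarrow> Bot \<notin> H
     \<and> (\<forall>p q. (p \<^bold>\<longrightarrow> q) \<in> H \<longleftrightarrow> (p \<in> H \<longrightarrow> q \<in> H))
     \<and> (\<forall>p. All p \<in> H \<longleftrightarrow> (\<forall>t. ninst t p \<in> H))
     \<and> (\<forall>p. AllS p \<in> H \<longleftrightarrow> (\<forall>X. sinst X p \<in> H))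
     \<and> (\<forall>t. (t \<^bold>= t) \<in> H)
     \<and> (\<forall>s t p. (s \<^bold>= t) \<in> H \<longrightarrow> ninst s p \<in> H \<longrightarrow> ninst t p \<in> H)
     \<and> (\<forall>p\<in>T. \<forall>\<sigma> \<rho>. nsubst \<sigma> (ssubst \<rho> p) \<in> H)"

text \<open>Variables serve as Henkin constants. Each stage is a finite list, so some variable is
  fresh for it; the axioms cause no clash, as they stand for their universal closures.\<close>

definition witnesses :: "fm list \<Rightarrow> fm \<Rightarrow> fm list" where
  "witnesses \<Gamma> p = (case p of
       (All q \<^bold>\<longrightarrow> Bot) \<Rightarrow>
         [\<^bold>\<not> ninst (Var (SOME v. (\<forall>r\<in>set \<Gamma>. nvars_below v r) \<and> nvars_below v q)) q]
     | (AllS q \<^bold>\<longrightarrow> Bot) \<Rightarrow>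
         [\<^bold>\<not> sinst (SOME v. (\<forall>r\<in>set \<Gamma>. svars_below v r) \<and> svars_below v q) q]
     | _ \<Rightarrow> [])"

definition extend :: "fm set \<Rightarrow> fm list \<Rightarrow> fm \<Rightarrow> fm list" where
  "extend T \<Gamma> p =
     (if T; p # \<Gamma> \<turnstile> Bot then (\<^bold>\<not> p) # \<Gamma> else witnesses (p # \<Gamma>) p @ p # \<Gamma>)"

primrec chain :: "fm set \<Rightarrow> fm list \<Rightarrow> nat \<Rightarrow> fm list" where
  "chain T \<Gamma> 0 = \<Gamma>"
| "chain T \<Gamma> (Suc n) = extend T (chain T \<Gamma> n) (from_nat n)"

lemma ex_fresh_nvar: "\<exists>v. (\<forall>r\<in>set \<Gamma>. nvars_below v r) \<and> nvars_below v q"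
proof (induction \<Gamma>)
  case Nil
  then show ?case using ex_nvars_below by simp
next
  case (Cons p \<Gamma>)
  then obtain v w where "(\<forall>r\<in>set \<Gamma>. nvars_below v r) \<and> nvars_below v q" "nvars_below w p"
    using ex_nvars_below by blast
  then show ?case by (intro exI[of _ "max v w"]) (metis nvars_below_mono max.cobounded1 max.cobounded2 set_ConsD)
qed

lemma ex_fresh_svar: "\<exists>v. (\<forall>r\<in>set \<Gamma>. svars_below v r) \<and> svars_below v q"
proof (induction \<Gamma>)
  case Nil
  then show ?case using ex_svars_below by simp
next
  case (Cons p \<Gamma>)
  then obtain v w where "(\<forall>r\<in>set \<Gamma>. svars_below v r) \<and> svars_below v q" "svars_below w p"
    using ex_svars_below by blast
  then show ?case by (intro exI[of _ "max v w"]) (metis svars_below_mono max.cobounded1 max.cobounded2 set_ConsD)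
qed

text \<open>If adding the negated instance at the fresh variable led to \<open>Bot\<close>, the
  instance would be provable, hence also the universal statement whose negation is in
  \<Gamma>.\<close>

lemma consistent_witnesses:
  assumes "\<not> T; \<Gamma> \<turnstile> Bot" "p \<in> set \<Gamma>" shows "\<not> T; witnesses \<Gamma> p @ \<Gamma> \<turnstile> Bot"
proof
  assume bot: "T; witnesses \<Gamma> p @ \<Gamma> \<turnstile> Bot"
  then have "witnesses \<Gamma> p \<noteq> []" using assms(1) by auto
  then consider q where "p = \<^bold>\<not> All q" | q where "p = \<^bold>\<not> AllS q"
    by (auto simp: witnesses_def split: fm.splits)
  then show False
  proof cases
    case 1
    define v where "v = (SOME v. (\<forall>r\<in>set \<Gamma>. nvars_below v r) \<and> nvars_below v q)"
    have v: "(\<forall>r\<in>set \<Gamma>. nvars_below v r) \<and> nvars_below v q"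
      unfolding v_def using ex_fresh_nvar by (rule someI_ex)
    have "T; \<Gamma> \<turnstile> ninst (Var v) q"
      by (rule Contr) (use bot in \<open>simp add: 1 witnesses_def v_def\<close>)
    then have "T; \<Gamma> \<turnstile> All q" using v by (intro AllI_fresh) auto
    then have "T; \<Gamma> \<turnstile> Bot" using assms(2) unfolding 1 by (rule ImpE[OF Hyp, rotated])
    then show False using assms(1) by contradiction
  next
    case 2
    define v where "v = (SOME v. (\<forall>r\<in>set \<Gamma>. svars_below v r) \<and> svars_below v q)"
    have v: "(\<forall>r\<in>set \<Gamma>. svars_below v r) \<and> svars_below v q"
      unfolding v_def using ex_fresh_svar by (rule someI_ex)
    have "T; \<Gamma> \<turnstile> sinst v q"
      by (rule Contr) (use bot in \<open>simp add: 2 witnesses_def v_def\<close>)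
    then have "T; \<Gamma> \<turnstile> AllS q" using v by (intro AllSI_fresh) auto
    then have "T; \<Gamma> \<turnstile> Bot" using assms(2) unfolding 2 by (rule ImpE[OF Hyp, rotated])
    then show False using assms(1) by contradiction
  qed
qed

lemma consistent_extend: "\<not> T; \<Gamma> \<turnstile> Bot \<Longrightarrow> \<not> T; extend T \<Gamma> p \<turnstile> Bot"
  unfolding extend_def
  using consistent_witnesses[of T "p # \<Gamma>" p] cut[OF NegI, of T p \<Gamma> Bot] by auto

lemma consistent_chain: "\<not> T; \<Gamma> \<turnstile> Bot \<Longrightarrow> \<not> T; chain T \<Gamma> n \<turnstile> Bot"
  by (induction n) (simp_all add: consistent_extend)

lemma chain_mono: "m \<le> n \<Longrightarrow> set (chain T \<Gamma> m) \<subseteq> set (chain T \<Gamma> n)"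
  by (rule lift_Suc_mono_le[of "\<lambda>n. set (chain T \<Gamma> n)"]) (auto simp: extend_def)

theorem henkin_extension:
  assumes "\<not> T; \<Gamma> \<turnstile> Bot"
  shows "\<exists>H. henkin T H \<and> set \<Gamma> \<subseteq> H"
proof -
  define H where "H = (\<Union>n. set (chain T \<Gamma> n))"
  \<comment> \<open>A list of hypotheses is finite and so lies within a single stage, which is
    consistent.\<close>
  have cons: "\<not> T; \<Delta> \<turnstile> Bot" if "set \<Delta> \<subseteq> H" for \<Delta>
  proof
    assume bot: "T; \<Delta> \<turnstile> Bot"
    have "\<exists>n. set \<Delta> \<subseteq> set (chain T \<Gamma> n)" using that
    proof (induction \<Delta>)
      case (Cons p \<Delta>)
      then obtain m n where "set \<Delta> \<subseteq> set (chain T \<Gamma> m)" "p \<in> set (chain T \<Gamma> n)"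
        by (auto simp: H_def)
      then have "set (p # \<Delta>) \<subseteq> set (chain T \<Gamma> (max m n))"
        using chain_mono[of m "max m n" T \<Gamma>] chain_mono[of n "max m n" T \<Gamma>] by auto
      then show ?case ..
    qed simp
    then obtain n where "set \<Delta> \<subseteq> set (chain T \<Gamma> n)" ..
    with bot have "T; chain T \<Gamma> n \<turnstile> Bot" by (rule weaken)
    then show False using consistent_chain[OF assms] by contradiction
  qed
  \<comment> \<open>Each formula is decided at the stage numbered by its own code.\<close>
  have stage: "set (extend T (chain T \<Gamma> (to_nat p)) p) \<subseteq> H" for p
  proof -
    have "extend T (chain T \<Gamma> (to_nat p)) p = chain T \<Gamma> (Suc (to_nat p))" by simp
    also have "set (chain T \<Gamma> (Suc (to_nat p))) \<subseteq> H" unfolding H_def by (rule UN_upper) simp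
    finally show ?thesis .
  qed
  have complete: "p \<in> H \<or> (\<^bold>\<not> p) \<in> H" for p
    using stage[of p] by (auto simp: extend_def split: if_splits)
  have ded: "p \<in> H" if "T; \<Delta> \<turnstile> p" "set \<Delta> \<subseteq> H" for \<Delta> p
  proof (rule ccontr)
    assume "p \<notin> H"
    then have "set ((\<^bold>\<not> p) # \<Delta>) \<subseteq> H" using complete that(2) by auto
    moreover have "T; (\<^bold>\<not> p) # \<Delta> \<turnstile> Bot"
      by (rule ImpE[OF Hyp weaken[OF that(1)]]) auto
    ultimately show False using cons[of "(\<^bold>\<not> p) # \<Delta>"] by simp
  qed
  have neg: "(\<^bold>\<not> p) \<in> H \<longleftrightarrow> p \<notin> H" for p
    using complete[of p] cons[of "[p, \<^bold>\<not> p]"] HypMP[of p "[p, \<^bold>\<not> p]" Bot T] by auto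
  have wit: "set (witnesses (p # chain T \<Gamma> (to_nat p)) p) \<subseteq> H" if "p \<in> H" for p
    using stage[of p] that neg[of p] by (auto simp: extend_def split: if_splits)
  have bot: "Bot \<notin> H" using cons[of "[Bot]"] Hyp[of Bot "[Bot]" T] by auto
  have imp: "(p \<^bold>\<longrightarrow> q) \<in> H \<longleftrightarrow> (p \<in> H \<longrightarrow> q \<in> H)" for p q
  proof
    assume "(p \<^bold>\<longrightarrow> q) \<in> H"
    then show "p \<in> H \<longrightarrow> q \<in> H"
      using ded[of "[p, p \<^bold>\<longrightarrow> q]" q] HypMP[of p "[p, p \<^bold>\<longrightarrow> q]" q T] by auto
  next
    assume "p \<in> H \<longrightarrow> q \<in> H"
    moreover have "T; [q] \<turnstile> p \<^bold>\<longrightarrow> q" by (rule ImpI, rule Hyp) simp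
    moreover have "T; [\<^bold>\<not> p] \<turnstile> p \<^bold>\<longrightarrow> q"
      by (rule ImpI, rule BotE, rule HypMP[of p]) auto
    ultimately show "(p \<^bold>\<longrightarrow> q) \<in> H"
      using neg ded by (metis empty_set empty_subsetI insert_subset list.simps(15))
  qed
  have all: "All p \<in> H \<longleftrightarrow> (\<forall>t. ninst t p \<in> H)" for p
  proof
    assume "All p \<in> H"
    then show "\<forall>t. ninst t p \<in> H" using ded[OF AllE, of "[All p]" p] by (simp add: Hyp)
  next
    assume *: "\<forall>t. ninst t p \<in> H"
    show "All p \<in> H"
    proof (rule ccontr)
      assume "All p \<notin> H"
      then have "(\<^bold>\<not> All p) \<in> H" by (simp add: neg)
      from wit[OF this] have "\<exists>t. (\<^bold>\<not> ninst t p) \<in> H" by (auto simp: witnesses_def)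
      then show False using * by (simp add: neg)
    qed
  qed
  have alls: "AllS p \<in> H \<longleftrightarrow> (\<forall>X. sinst X p \<in> H)" for p
  proof
    assume "AllS p \<in> H"
    then show "\<forall>X. sinst X p \<in> H" using ded[OF AllSE, of "[AllS p]" p] by (simp add: Hyp)
  next
    assume *: "\<forall>X. sinst X p \<in> H"
    show "AllS p \<in> H"
    proof (rule ccontr)
      assume "AllS p \<notin> H"
      then have "(\<^bold>\<not> AllS p) \<in> H" by (simp add: neg)
      from wit[OF this] have "\<exists>X. (\<^bold>\<not> sinst X p) \<in> H" by (auto simp: witnesses_def)
      then show False using * by (simp add: neg)
    qed
  qed
  have refl: "(t \<^bold>= t) \<in> H" for t using ded[OF EqRefl, of "[]"] by simp
  have eq: "ninst t p \<in> H" if "(s \<^bold>= t) \<in> H" "ninst s p \<in> H" for s t p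
  proof (rule ded)
    show "T; [s \<^bold>= t, ninst s p] \<turnstile> ninst t p"
      by (rule EqSubst[where s = s, OF Hyp Hyp]) simp_all
  qed (use that in simp)
  have ax: "nsubst \<sigma> (ssubst \<rho> p) \<in> H" if "p \<in> T" for \<sigma> \<rho> p
    by (rule ded[OF provable_nsubst_closed[OF provable_ssubst_closed[OF Axiom[OF that]]]]) simp
  have sub: "set \<Gamma> \<subseteq> H"
    unfolding H_def using UN_upper[of 0 UNIV "\<lambda>n. set (chain T \<Gamma> n)"] by simp
  have "henkin T H"
    unfolding henkin_def
    by (intro conjI allI ballI impI bot imp all alls refl ax) (rule eq)
  with sub show ?thesis by blast
qed


section \<open>Semantics\<close>

primrec eval :: "(nat \<Rightarrow> 'a::{zero,one,plus,times}) \<Rightarrow> trm \<Rightarrow> 'a" where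
  "eval e (Var i) = e i"
| "eval e Zero = 0"
| "eval e One = 1"
| "eval e (s \<^bold>+ t) = eval e s + eval e t"
| "eval e (s \<^bold>* t) = eval e s * eval e t"

primrec sat :: "'a::{zero,one,plus,times,ord} set set \<Rightarrow> (nat \<Rightarrow> 'a) \<Rightarrow> (nat \<Rightarrow> 'a set) \<Rightarrow> fm \<Rightarrow> bool"
where
  "sat \<S> e \<rho> Bot \<longleftrightarrow> False"
| "sat \<S> e \<rho> (s \<^bold>= t) \<longleftrightarrow> eval e s = eval e t"
| "sat \<S> e \<rho> (s \<^bold>< t) \<longleftrightarrow> eval e s < eval e t"
| "sat \<S> e \<rho> (t \<^bold>\<in> X) \<longleftrightarrow> eval e t \<in> \<rho> X"
| "sat \<S> e \<rho> (p \<^bold>\<longrightarrow> q) \<longleftrightarrow> (sat \<S> e \<rho> p \<longrightarrow> sat \<S> e \<rho> q)"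
| "sat \<S> e \<rho> (All p) \<longleftrightarrow> (\<forall>x. sat \<S> (case_nat x e) \<rho> p)"
| "sat \<S> e \<rho> (AllS p) \<longleftrightarrow> (\<forall>X\<in>\<S>. sat \<S> e (case_nat X \<rho>) p)"

lemma sat_connectives [simp]:
  "sat \<S> e \<rho> (\<^bold>\<not> p) \<longleftrightarrow> \<not> sat \<S> e \<rho> p"
  "sat \<S> e \<rho> (p \<^bold>\<and> q) \<longleftrightarrow> sat \<S> e \<rho> p \<and> sat \<S> e \<rho> q"
  "sat \<S> e \<rho> (p \<^bold>\<or> q) \<longleftrightarrow> sat \<S> e \<rho> p \<or> sat \<S> e \<rho> q"
  "sat \<S> e \<rho> (p \<^bold>\<longleftrightarrow> q) \<longleftrightarrow> (sat \<S> e \<rho> p \<longleftrightarrow> sat \<S> e \<rho> q)"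
  "sat \<S> e \<rho> (Ex p) \<longleftrightarrow> (\<exists>x. sat \<S> (case_nat x e) \<rho> p)"
  "sat \<S> e \<rho> (ExS p) \<longleftrightarrow> (\<exists>X\<in>\<S>. sat \<S> e (case_nat X \<rho>) p)"
  by auto

lemma eval_tsubst: "eval e (tsubst \<sigma> t) = eval (\<lambda>i. eval e (\<sigma> i)) t"
  by (induction t) auto

lemma eval_tshift [simp]: "eval (case_nat x e) (tshift t) = eval e t"
  by (simp add: tshift_def eval_tsubst)

lemma sat_nsubst: "sat \<S> e \<rho> (nsubst \<sigma> p) \<longleftrightarrow> sat \<S> (\<lambda>i. eval e (\<sigma> i)) \<rho> p"
proof (induction p arbitrary: e \<rho> \<sigma>)
  case (All p)
  have "(\<lambda>i. eval (case_nat x e) (up \<sigma> i)) = case_nat x (\<lambda>i. eval e (\<sigma> i))" for x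
    by (rule ext, case_tac i) auto
  then show ?case by (simp add: All)
qed (auto simp: eval_tsubst)

lemma sat_ssubst: "sat \<S> e \<rho> (ssubst \<sigma> p) \<longleftrightarrow> sat \<S> e (\<lambda>i. \<rho> (\<sigma> i)) p"
proof (induction p arbitrary: e \<rho> \<sigma>)
  case (AllS p)
  have "(\<lambda>i. case_nat X \<rho> (case_nat 0 (\<lambda>i. Suc (\<sigma> i)) i)) = case_nat X (\<lambda>i. \<rho> (\<sigma> i))" for X
    by (rule ext, case_tac i) auto
  then show ?case by (simp add: AllS)
qed auto

lemma case_nat_comp: "(\<lambda>i. f (case_nat x g i)) = case_nat (f x) (\<lambda>i. f (g i))"
  by (rule ext, case_tac i) auto

lemma sat_ninst [simp]: "sat \<S> e \<rho> (ninst t p) \<longleftrightarrow> sat \<S> (case_nat (eval e t) e) \<rho> p"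
proof -
  have "(\<lambda>i. eval e (case_nat t Var i)) = case_nat (eval e t) e"
    by (rule ext, case_tac i) auto
  then show ?thesis by (simp add: ninst_def sat_nsubst)
qed

lemma sat_sinst [simp]: "sat \<S> e \<rho> (sinst X p) \<longleftrightarrow> sat \<S> e (case_nat (\<rho> X) \<rho>) p"
proof -
  have "(\<lambda>i. \<rho> (case_nat X (\<lambda>i. i) i)) = case_nat (\<rho> X) \<rho>"
    by (rule ext, case_tac i) auto
  then show ?thesis by (simp add: sinst_def sat_ssubst)
qed

lemma sat_sshift [simp]: "sat \<S> e (case_nat X \<rho>) (sshift p) \<longleftrightarrow> sat \<S> e \<rho> p"
  by (simp add: sshift_def sat_ssubst)

lemma sat_subst_succ [simp]:
  "sat \<S> (case_nat x e) \<rho> (subst_succ p) \<longleftrightarrow> sat \<S> (case_nat (x + 1) e) \<rho> p"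
proof -
  have "(\<lambda>i. eval (case_nat x e) (case_nat (Var 0 \<^bold>+ One) (\<lambda>i. Var (Suc i)) i))
      = case_nat (x + 1) e"
    by (rule ext, case_tac i) auto
  then show ?thesis by (simp add: subst_succ_def sat_nsubst)
qed

text \<open>\<open>RCA0\<close> without comprehension: the part that survives in the natural numbers
  with the empty set as the only set.\<close>

definition arith_axioms :: "fm set" where
  "arith_axioms = basic_axioms \<union> {induction p | p. p \<in> Sigma01}"

primrec numeral_trm :: "nat \<Rightarrow> trm" where
  "numeral_trm 0 = Zero"
| "numeral_trm (Suc n) = numeral_trm n \<^bold>+ One"

lemma eval_numeral_trm [simp]: "eval e (numeral_trm n) = (n :: nat)"
  by (induction n) auto

lemma sat_arith_axioms:
  fixes e :: "nat \<Rightarrow> nat"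
  assumes "p \<in> arith_axioms" shows "sat {{}} e \<rho> p"
proof (cases "p \<in> basic_axioms")
  case True
  then show ?thesis by (auto simp: basic_axioms_def)
next
  case False
  then obtain q where q: "p = Defs.induction q" using assms by (auto simp: arith_axioms_def)
  have "sat {{}} (case_nat n e) \<rho> q"
    if "sat {{}} (case_nat 0 e) \<rho> q"
      "\<forall>x. sat {{}} (case_nat x e) \<rho> q \<longrightarrow> sat {{}} (case_nat (x + 1) e) \<rho> q" for n
  proof (induction n)
    case (Suc n)
    then show ?case using that(2)[rule_format, of n] by (simp only: Suc_eq_plus1)
  qed (fact that)
  moreover have "sat {{}} e \<rho> p \<longleftrightarrow> (sat {{}} (case_nat 0 e) \<rho> q \<and>
      (\<forall>x. sat {{}} (case_nat x e) \<rho> q \<longrightarrow> sat {{}} (case_nat (x + 1) e) \<rho> q) \<longrightarrow>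
      (\<forall>n. sat {{}} (case_nat n e) \<rho> q))"
    unfolding q Defs.induction_def by simp
  ultimately show ?thesis by blast
qed

text \<open>Every natural number is the value of a numeral, so quantifying over numbers amounts to
  quantifying over terms.\<close>

lemma henkin_nat:
  "henkin arith_axioms {p. sat {{}} (\<lambda>_. 0 :: nat) (\<lambda>_. {}) p}"
proof -
  have "(\<forall>x. P x) \<longleftrightarrow> (\<forall>t. P (eval (\<lambda>_. 0) t))" for P :: "nat \<Rightarrow> bool"
    by (metis eval_numeral_trm)
  note all = this[of "\<lambda>x. sat {{}} (case_nat x (\<lambda>_. 0)) (\<lambda>_. {}) p" for p]
  show ?thesis
    unfolding henkin_def
    by (intro conjI allI ballI impI)
      (simp_all add: all[symmetric] sat_nsubst sat_ssubst sat_arith_axioms)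
qed

lemma henkin_mono: "henkin T H \<Longrightarrow> U \<subseteq> T \<Longrightarrow> henkin U H"
  unfolding henkin_def by blast


section \<open>The canonical model\<close>

definition target :: fm where
  "target = All (AllS (AllS (
       graph 1 0 \<^bold>\<and> bounded_graph 1 0 \<^bold>\<and> locally_chromatic 1 0 (Var 0) \<^bold>\<longrightarrow>
       All (twice_minus_one (Var 0) (Var 1) \<^bold>\<longrightarrow> chromatic 1 0 (Var 0)))))"

text \<open>
  The model is a type, so that the type classes for arithmetic are available in it. As a type has
  to exist unconditionally, true arithmetic takes the place of the missing Henkin set if there is
  no countermodel.
\<close>

definition canon :: "fm set" where
  "canon = (if \<exists>H. henkin RCA0 H \<and> (\<^bold>\<not> target) \<in> H
     then SOME H. henkin RCA0 H \<and> (\<^bold>\<not> target) \<in> H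
     else {p. sat {{}} (\<lambda>_. 0 :: nat) (\<lambda>_. {}) p})"

lemma canon_RCA0:
  assumes "\<not> RCA0; [] \<turnstile> target"
  shows "henkin RCA0 canon" "(\<^bold>\<not> target) \<in> canon"
proof -
  have "\<not> RCA0; [\<^bold>\<not> target] \<turnstile> Bot" using assms Contr by blast
  then have *: "\<exists>H. henkin RCA0 H \<and> (\<^bold>\<not> target) \<in> H" using henkin_extension by fastforce
  then have "henkin RCA0 canon \<and> (\<^bold>\<not> target) \<in> canon"
    unfolding canon_def using someI_ex[OF *] by simp
  then show "henkin RCA0 canon" "(\<^bold>\<not> target) \<in> canon" by auto
qed

lemma henkin_canon: "henkin arith_axioms canon"
proof (cases "\<exists>H. henkin RCA0 H \<and> (\<^bold>\<not> target) \<in> H")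
  case True
  then have "henkin RCA0 canon" unfolding canon_def using someI_ex[OF True] by simp
  then show ?thesis by (rule henkin_mono) (auto simp: arith_axioms_def RCA0_def)
next
  case False
  show ?thesis unfolding canon_def if_not_P[OF False] by (rule henkin_nat)
qed

lemma canon_simps [simp]:
  "Bot \<notin> canon"
  "(p \<^bold>\<longrightarrow> q) \<in> canon \<longleftrightarrow> (p \<in> canon \<longrightarrow> q \<in> canon)"
  "All p \<in> canon \<longleftrightarrow> (\<forall>t. ninst t p \<in> canon)"
  "AllS p \<in> canon \<longleftrightarrow> (\<forall>X. sinst X p \<in> canon)"
  "(t \<^bold>= t) \<in> canon"
  using henkin_canon unfolding henkin_def by simp_all

lemma canon_subst: "(s \<^bold>= t) \<in> canon \<Longrightarrow> ninst s p \<in> canon \<Longrightarrow> ninst t p \<in> canon"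
  using henkin_canon unfolding henkin_def by simp

definition teq :: "trm \<Rightarrow> trm \<Rightarrow> bool" where
  "teq s t \<longleftrightarrow> (s \<^bold>= t) \<in> canon"

lemma ninst_simps:
  "ninst t (r \<^bold>= s) = (tsubst (case_nat t Var) r \<^bold>= tsubst (case_nat t Var) s)"
  "ninst t (r \<^bold>< s) = (tsubst (case_nat t Var) r \<^bold>< tsubst (case_nat t Var) s)"
  "ninst t (r \<^bold>\<in> X) = (tsubst (case_nat t Var) r \<^bold>\<in> X)"
  by (simp_all add: ninst_def)

lemma teq_sym: "teq s t \<Longrightarrow> teq t s"
  using canon_subst[of s t "Var 0 \<^bold>= tshift s"]
  by (simp add: teq_def ninst_simps tsubst_tshift)

lemma teq_trans: "teq r s \<Longrightarrow> teq s t \<Longrightarrow> teq r t"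
  using canon_subst[of s t "tshift r \<^bold>= Var 0"]
  by (simp add: teq_def ninst_simps tsubst_tshift)

lemma equivp_teq: "equivp teq"
proof (rule equivpI)
  show "reflp teq" by (auto simp: reflp_def teq_def)
  show "symp teq" by (auto simp: symp_def intro: teq_sym)
  show "transp teq" by (auto simp: transp_def intro: teq_trans)
qed

lemma teq_cong:
  assumes "teq s s'" "teq t t'"
  shows "teq (s \<^bold>+ t) (s' \<^bold>+ t')" "teq (s \<^bold>* t) (s' \<^bold>* t')"
    "(s \<^bold>< t) \<in> canon \<Longrightarrow> (s' \<^bold>< t') \<in> canon"
    "(s \<^bold>\<in> X) \<in> canon \<Longrightarrow> (s' \<^bold>\<in> X) \<in> canon"
  using assms
    canon_subst[of s s' "tshift (s \<^bold>+ t) \<^bold>= Var 0 \<^bold>+ tshift t"]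
    canon_subst[of t t' "tshift (s \<^bold>+ t) \<^bold>= tshift s' \<^bold>+ Var 0"]
    canon_subst[of s s' "tshift (s \<^bold>* t) \<^bold>= Var 0 \<^bold>* tshift t"]
    canon_subst[of t t' "tshift (s \<^bold>* t) \<^bold>= tshift s' \<^bold>* Var 0"]
    canon_subst[of s s' "Var 0 \<^bold>< tshift t"]
    canon_subst[of t t' "tshift s' \<^bold>< Var 0"]
    canon_subst[of s s' "Var 0 \<^bold>\<in> X"]
  by (simp_all add: teq_def ninst_simps tsubst_tshift)

quotient_type M = trm / teq
  by (rule equivp_teq)

instantiation M :: "{zero,one,plus,times,ord}"
begin

lift_definition zero_M :: M is Zero .
lift_definition one_M :: M is One .
lift_definition plus_M :: "M \<Rightarrow> M \<Rightarrow> M" is "(\<^bold>+)" by (rule teq_cong)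
lift_definition times_M :: "M \<Rightarrow> M \<Rightarrow> M" is "(\<^bold>*)" by (rule teq_cong)
lift_definition less_M :: "M \<Rightarrow> M \<Rightarrow> bool" is "\<lambda>s t. (s \<^bold>< t) \<in> canon"
  using teq_cong(3) teq_sym by blast
definition less_eq_M :: "M \<Rightarrow> M \<Rightarrow> bool" where "less_eq_M x y \<longleftrightarrow> x < y \<or> x = y"

instance ..

end

lift_definition mem_M :: "M \<Rightarrow> nat \<Rightarrow> bool" is "\<lambda>t X. (t \<^bold>\<in> X) \<in> canon"
  using teq_cong(4) teq_sym by blast

definition sbase :: "nat \<Rightarrow> M set" where
  "sbase X = {x. mem_M x X}"

definition base :: "nat \<Rightarrow> M" where
  "base i = abs_M (Var i)"

abbreviation Sets :: "M set set" where
  "Sets \<equiv> range sbase"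

abbreviation satM :: "(nat \<Rightarrow> M) \<Rightarrow> (nat \<Rightarrow> M set) \<Rightarrow> fm \<Rightarrow> bool" where
  "satM \<equiv> sat Sets"

lemma eval_abs: "eval (\<lambda>i. abs_M (\<sigma> i)) t = abs_M (tsubst \<sigma> t)"
  by (induction t) (simp_all add: zero_M_def one_M_def plus_M.abs_eq times_M.abs_eq)

lemma eval_base: "eval base t = abs_M t"
  using eval_abs[of Var t] by (simp add: base_def[abs_def])

lemma surj_abs_M: "\<exists>t. x = abs_M t"
  by (metis Quotient_M Quotient_abs_rep)

text \<open>Every element is the class of a term and every set is named by a set variable, so the
  quantifiers of the model range over exactly the instances that occur in the Henkin
  conditions.\<close>

lemma truth: "satM (\<lambda>i. abs_M (\<sigma> i)) (\<lambda>i. sbase (\<rho> i)) p \<longleftrightarrow> nsubst \<sigma> (ssubst \<rho> p) \<in> canon"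
proof (induction p arbitrary: \<sigma> \<rho>)
  case (Eq s t)
  then show ?case by (simp add: eval_abs M.abs_eq_iff teq_def)
next
  case (Less s t)
  then show ?case by (simp add: eval_abs less_M.abs_eq)
next
  case (Mem t X)
  then show ?case by (simp add: eval_abs sbase_def mem_M.abs_eq)
next
  case (All p)
  have "satM (\<lambda>i. abs_M (\<sigma> i)) (\<lambda>i. sbase (\<rho> i)) (All p)
      \<longleftrightarrow> (\<forall>t. satM (case_nat (abs_M t) (\<lambda>i. abs_M (\<sigma> i))) (\<lambda>i. sbase (\<rho> i)) p)"
    using surj_abs_M by (metis sat.simps(6))
  also have "\<dots> \<longleftrightarrow> (\<forall>t. nsubst (case_nat t \<sigma>) (ssubst \<rho> p) \<in> canon)"
    using All.IH[of "case_nat _ \<sigma>"] by (simp add: case_nat_comp)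
  finally show ?case by (simp add: ninst_nsubst_up)
next
  case (AllS p)
  have "satM (\<lambda>i. abs_M (\<sigma> i)) (\<lambda>i. sbase (\<rho> i)) (AllS p)
      \<longleftrightarrow> (\<forall>X. satM (\<lambda>i. abs_M (\<sigma> i)) (case_nat (sbase X) (\<lambda>i. sbase (\<rho> i))) p)"
    by simp
  also have "\<dots> \<longleftrightarrow> (\<forall>X. nsubst \<sigma> (ssubst (case_nat X \<rho>) p) \<in> canon)"
    using AllS.IH[of \<sigma> "case_nat _ \<rho>"] by (simp add: case_nat_comp)
  finally show ?case by (simp add: sinst_ssubst_up nsubst_ssubst)
qed auto

text \<open>Any assignment is named by a substitution of terms, and a Henkin set contains all
  substitution instances of the axioms.\<close>

lemma satM_axiom:
  assumes "henkin T canon" "p \<in> T"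
  shows "satM e sbase p"
proof -
  define \<sigma> where "\<sigma> i = (SOME t. e i = abs_M t)" for i
  have "e = (\<lambda>i. abs_M (\<sigma> i))"
    unfolding \<sigma>_def using someI_ex[OF surj_abs_M] by (intro ext)
  then show ?thesis
    using assms truth[of \<sigma> "\<lambda>i. i" p] ssubst_id[of p] unfolding henkin_def by (metis ssubst_id)
qed


section \<open>Definability by bounded formulas\<close>

text \<open>
  The first \<open>d\<close> values of the environment are the arguments, the others are fixed. As every
  element and every set of the model is denoted by a term or a set variable, all of them are
  available as parameters.
\<close>

definition tfun :: "nat \<Rightarrow> ((nat \<Rightarrow> M) \<Rightarrow> M) \<Rightarrow> bool" where
  "tfun d f \<longleftrightarrow> (\<exists>t. \<forall>e. (\<forall>i. e (i + d) = base i) \<longrightarrow> f e = eval e t)"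

definition delta0 :: "nat \<Rightarrow> ((nat \<Rightarrow> M) \<Rightarrow> bool) \<Rightarrow> bool" where
  "delta0 d P \<longleftrightarrow>
     (\<exists>p. bounded_fm p \<and> (\<forall>e. (\<forall>i. e (i + d) = base i) \<longrightarrow> (P e \<longleftrightarrow> satM e sbase p)))"

lemma tfun_var: "tfun d (\<lambda>e. e i)"
  unfolding tfun_def by (intro exI[of _ "Var i"]) simp

lemma tfun_const: "tfun d (\<lambda>e. a)"
proof -
  obtain t where t: "a = abs_M t" using surj_abs_M by blast
  \<comment> \<open>Raising the indices by \<open>d\<close> skips the argument slots, after which
    variable \<open>i\<close> again denotes \<open>base i\<close>.\<close>
  have "a = eval e (tsubst (\<lambda>i. Var (i + d)) t)" if "\<forall>i. e (i + d) = base i" for e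
    using that by (simp add: t eval_tsubst eval_base)
  then show ?thesis unfolding tfun_def by blast
qed

lemma tfun_add: "tfun d f \<Longrightarrow> tfun d g \<Longrightarrow> tfun d (\<lambda>e. f e + g e)"
  unfolding tfun_def by (metis eval.simps(4))

lemma tfun_mult: "tfun d f \<Longrightarrow> tfun d g \<Longrightarrow> tfun d (\<lambda>e. f e * g e)"
  unfolding tfun_def by (metis eval.simps(5))

lemma delta0_eq: "tfun d f \<Longrightarrow> tfun d g \<Longrightarrow> delta0 d (\<lambda>e. f e = g e)"
  unfolding tfun_def delta0_def by (metis sat.simps(2) bounded_fm.intros(2))

lemma delta0_less: "tfun d f \<Longrightarrow> tfun d g \<Longrightarrow> delta0 d (\<lambda>e. f e < g e)"
  unfolding tfun_def delta0_def by (metis sat.simps(3) bounded_fm.intros(3))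

lemma delta0_mem: "X \<in> Sets \<Longrightarrow> tfun d f \<Longrightarrow> delta0 d (\<lambda>e. f e \<in> X)"
  unfolding tfun_def delta0_def by (metis sat.simps(4) bounded_fm.intros(4) imageE)

lemma delta0_imp: "delta0 d P \<Longrightarrow> delta0 d Q \<Longrightarrow> delta0 d (\<lambda>e. P e \<longrightarrow> Q e)"
  unfolding delta0_def by (metis sat.simps(5) bounded_fm.intros(5))

lemma delta0_const: "delta0 d (\<lambda>e. c)"
proof (cases c)
  case True
  then show ?thesis
    unfolding delta0_def by (intro exI[of _ "Bot \<^bold>\<longrightarrow> Bot"]) (auto intro: bounded_fm.intros)
next
  case False
  then show ?thesis unfolding delta0_def by (intro exI[of _ Bot]) (auto intro: bounded_fm.intros)
qed

lemma delta0_not: "delta0 d P \<Longrightarrow> delta0 d (\<lambda>e. \<not> P e)"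
  using delta0_imp[OF _ delta0_const[of d False]] by simp

lemma delta0_and: "delta0 d P \<Longrightarrow> delta0 d Q \<Longrightarrow> delta0 d (\<lambda>e. P e \<and> Q e)"
  using delta0_not[OF delta0_imp[OF _ delta0_not]] by simp

lemma delta0_or: "delta0 d P \<Longrightarrow> delta0 d Q \<Longrightarrow> delta0 d (\<lambda>e. P e \<or> Q e)"
  using delta0_imp[OF delta0_not] by (simp add: disj_imp)

lemma delta0_iff: "delta0 d P \<Longrightarrow> delta0 d Q \<Longrightarrow> delta0 d (\<lambda>e. P e \<longleftrightarrow> Q e)"
  using delta0_and[OF delta0_imp delta0_imp] by (simp add: iff_conv_conj_imp)

lemma delta0_le: "tfun d f \<Longrightarrow> tfun d g \<Longrightarrow> delta0 d (\<lambda>e. f e \<le> g e)"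
  unfolding less_eq_M_def by (intro delta0_or delta0_less delta0_eq)

lemma delta0_all:
  assumes "tfun d t" "delta0 (Suc d) (\<lambda>e. P (e 0) (\<lambda>i. e (Suc i)))"
  shows "delta0 d (\<lambda>e. \<forall>x<t e. P x e)"
proof -
  obtain s where s: "t e = eval e s" if "\<forall>i. e (i + d) = base i" for e
    using assms(1) unfolding tfun_def by blast
  obtain p where p: "bounded_fm p"
    "\<And>e. \<forall>i. e (i + Suc d) = base i \<Longrightarrow> (P (e 0) (\<lambda>i. e (Suc i)) \<longleftrightarrow> satM e sbase p)"
    using assms(2) unfolding delta0_def by blast
  have "(\<forall>x<t e. P x e) \<longleftrightarrow> satM e sbase (All (Var 0 \<^bold>< tshift s \<^bold>\<longrightarrow> p))"
    if e: "\<forall>i. e (i + d) = base i" for e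
    using s[OF e] p(2)[of "case_nat _ e"] e by simp
  moreover have "bounded_fm (All (Var 0 \<^bold>< tshift s \<^bold>\<longrightarrow> p))"
    by (intro bounded_fm.intros p(1)) 
  ultimately show ?thesis unfolding delta0_def by blast
qed

lemma delta0_ex:
  assumes "tfun d t" "delta0 (Suc d) (\<lambda>e. P (e 0) (\<lambda>i. e (Suc i)))"
  shows "delta0 d (\<lambda>e. \<exists>x<t e. P x e)"
  using delta0_not[OF delta0_all[OF assms(1) delta0_not[OF assms(2)]]] by simp

lemmas delta0_intros = tfun_var tfun_const tfun_add tfun_mult delta0_eq delta0_less delta0_le
  delta0_mem delta0_imp delta0_not delta0_and delta0_or delta0_iff delta0_all delta0_ex

section \<open>Semantic forms of induction and comprehension\<close>

lemma sigma1_induct: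
  assumes Q: "delta0 (Suc (Suc 0)) (\<lambda>e. Q (e 0) (e (Suc 0)))"
    and zero: "\<exists>y. Q y 0"
    and step: "\<And>x y. Q y x \<Longrightarrow> \<exists>y. Q y (x + 1)"
  shows "\<exists>y. Q y x"
proof -
  obtain p where p: "bounded_fm p"
    "\<And>e. \<forall>i. e (i + Suc (Suc 0)) = base i \<Longrightarrow> (Q (e 0) (e (Suc 0)) \<longleftrightarrow> satM e sbase p)"
    using Q unfolding delta0_def by blast
  have sat: "satM (case_nat y (case_nat x base)) sbase p \<longleftrightarrow> Q y x" for x y
    using p(2)[of "case_nat y (case_nat x base)"] by simp
  have "Defs.induction (Ex p) \<in> arith_axioms"
    using p(1) by (auto simp: arith_axioms_def Sigma01_def)
  from satM_axiom[OF henkin_canon this, of base]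
  have "satM base sbase (Defs.induction (Ex p))" .
  moreover have "satM base sbase (Defs.induction (Ex p)) \<longleftrightarrow>
      ((\<exists>y. Q y 0) \<and> (\<forall>x. (\<exists>y. Q y x) \<longrightarrow> (\<exists>y. Q y (x + 1))) \<longrightarrow> (\<forall>x. \<exists>y. Q y x))"
    unfolding Defs.induction_def
    by (subst sat.simps(5))
      (simp only: sat_connectives(2,5) sat.simps(6) sat.simps(5)[where q = "subst_succ r" for r]
        sat_ninst sat_subst_succ eval.simps sat)
  ultimately show ?thesis using zero step by blast
qed

text \<open>A vacuous quantifier makes a bounded formula Sigma01: slot 0 holds its dummy witness,
  slot 1 the induction variable.\<close>

lemma delta0_induct:
  assumes "delta0 (Suc (Suc 0)) (\<lambda>e. Q (e (Suc 0)))"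
    and "Q 0" and "\<And>x. Q x \<Longrightarrow> Q (x + 1)"
  shows "Q x"
  using sigma1_induct[of "\<lambda>_. Q"] assms by simp

text \<open>Comprehension in the model depends on this assumption, which follows from the
  unprovability of \<open>target\<close>. Arithmetic and Sigma01 induction hold in the model in any
  case.\<close>

locale rca =
  assumes henkin_RCA0: "henkin RCA0 canon"
begin

text \<open>\<open>Q\<close> is a Sigma01 description of the complement; its negation is the Pi01
  formula that the comprehension scheme asks for.\<close>

lemma delta1_comprehension:
  assumes P: "delta0 (Suc (Suc 0)) (\<lambda>e. P (e 0) (e (Suc 0)))"
    and Q: "delta0 (Suc (Suc 0)) (\<lambda>e. Q (e 0) (e (Suc 0)))"
    and iff: "\<And>x. (\<exists>y. P y x) \<longleftrightarrow> \<not> (\<exists>y. Q y x)"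
  shows "\<exists>X\<in>Sets. \<forall>x. x \<in> X \<longleftrightarrow> (\<exists>y. P y x)"
proof -
  obtain p where p: "bounded_fm p"
    "\<And>e. \<forall>i. e (i + Suc (Suc 0)) = base i \<Longrightarrow> (P (e 0) (e (Suc 0)) \<longleftrightarrow> satM e sbase p)"
    using P unfolding delta0_def by blast
  obtain q where q: "bounded_fm q"
    "\<And>e. \<forall>i. e (i + Suc (Suc 0)) = base i \<Longrightarrow> (\<not> Q (e 0) (e (Suc 0)) \<longleftrightarrow> satM e sbase q)"
    using delta0_not[OF Q] unfolding delta0_def by blast
  have sat: "satM (case_nat y (case_nat x base)) sbase p \<longleftrightarrow> P y x"
    "satM (case_nat y (case_nat x base)) sbase q \<longleftrightarrow> \<not> Q y x" for x y
    using p(2)[of "case_nat y (case_nat x base)"] q(2)[of "case_nat y (case_nat x base)"]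
    by simp_all
  have "comprehension (Ex p) (All q) \<in> RCA0"
    using p(1) q(1) by (auto simp: RCA0_def Sigma01_def Pi01_def)
  from satM_axiom[OF henkin_RCA0 this, of base]
  have "satM base sbase (comprehension (Ex p) (All q))" .
  moreover have "satM base sbase (comprehension (Ex p) (All q)) \<longleftrightarrow>
      ((\<forall>x. (\<exists>y. P y x) \<longleftrightarrow> (\<forall>y. \<not> Q y x)) \<longrightarrow> (\<exists>X. \<forall>x. x \<in> sbase X \<longleftrightarrow> (\<exists>y. P y x)))"
    unfolding comprehension_def
    by (subst sat.simps(5))
      (simp only: sat_connectives(4-6) sat.simps(4,6) sat_sshift eval.simps nat.case sat
        bex_simps)
  moreover have "\<forall>x. (\<exists>y. P y x) \<longleftrightarrow> (\<forall>y. \<not> Q y x)" using iff by simp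
  ultimately show ?thesis by (simp only: bex_simps) simp
qed

lemma delta0_comprehension:
  assumes "delta0 (Suc (Suc 0)) (\<lambda>e. P (e (Suc 0)))"
  shows "\<exists>X\<in>Sets. \<forall>x. x \<in> X \<longleftrightarrow> P x"
  using delta1_comprehension[of "\<lambda>_. P" "\<lambda>_ x. \<not> P x"] assms delta0_not[OF assms] by simp

end


section \<open>Arithmetic in the model\<close>

lemma M_basic:
  fixes x y :: M
  shows "x + 1 \<noteq> 0" "x + 1 = y + 1 \<Longrightarrow> x = y" "x + 0 = x" "x + (y + 1) = (x + y) + 1"
    "x * 0 = 0" "x * (y + 1) = x * y + x" "\<not> x < 0" "x < y + 1 \<longleftrightarrow> x < y \<or> x = y"
proof -
  have "\<forall>p\<in>basic_axioms. satM (case_nat x (\<lambda>_. y)) sbase p"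
    using satM_axiom[OF henkin_canon] by (auto simp: arith_axioms_def)
  then show "x + 1 \<noteq> 0" "x + 1 = y + 1 \<Longrightarrow> x = y" "x + 0 = x" "x + (y + 1) = (x + y) + 1"
    "x * 0 = 0" "x * (y + 1) = x * y + x" "\<not> x < 0" "x < y + 1 \<longleftrightarrow> x < y \<or> x = y"
    by (auto simp: basic_axioms_def)
qed

lemma M_add_0: "0 + x = (x :: M)"
proof (rule delta0_induct[where Q = "\<lambda>x. 0 + x = x"])
  show "0 + (x + 1) = x + 1" if "0 + x = x" for x :: M using that by (simp add: M_basic)
qed (intro delta0_intros, simp add: M_basic)

lemma M_add_assoc: "a + b + c = a + (b + c :: M)"
proof (rule delta0_induct[where Q = "\<lambda>c. a + b + c = a + (b + c)"])
  show "a + b + (c + 1) = a + (b + (c + 1))" if "a + b + c = a + (b + c)" for c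
    using that by (simp add: M_basic)
qed (intro delta0_intros, simp add: M_basic)

lemma M_add_1: "1 + x = x + (1 :: M)"
proof (rule delta0_induct[where Q = "\<lambda>x. 1 + x = x + 1"])
  show "1 + (x + 1) = (x + 1) + 1" if "1 + x = x + 1" for x :: M
    using that by (simp add: M_basic)
qed (intro delta0_intros, simp add: M_basic M_add_0)

lemma M_add_comm: "x + y = y + (x :: M)"
proof (rule delta0_induct[where Q = "\<lambda>y. x + y = y + x"])
  show "x + (y + 1) = (y + 1) + x" if "x + y = y + x" for y
    using that by (metis M_add_1 M_add_assoc)
qed (intro delta0_intros, simp add: M_basic M_add_0)

lemma M_distrib: "x * (y + z) = x * y + x * (z :: M)"
proof (rule delta0_induct[where Q = "\<lambda>z. x * (y + z) = x * y + x * z"])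
  show "x * (y + (z + 1)) = x * y + x * (z + 1)" if "x * (y + z) = x * y + x * z" for z
    using that by (simp add: M_basic M_add_assoc[symmetric])
qed (intro delta0_intros, simp add: M_basic M_add_0)

lemma M_mult_assoc: "x * y * z = x * (y * z :: M)"
proof (rule delta0_induct[where Q = "\<lambda>z. x * y * z = x * (y * z)"])
  show "x * y * (z + 1) = x * (y * (z + 1))" if "x * y * z = x * (y * z)" for z
    using that by (metis M_basic(6) M_distrib)
qed (intro delta0_intros, simp add: M_basic)

lemma M_mult_0: "0 * x = (0 :: M)"
proof (rule delta0_induct[where Q = "\<lambda>x. 0 * x = 0"])
  show "0 * (x + 1) = 0" if "0 * x = 0" for x :: M using that by (simp add: M_basic)
qed (intro delta0_intros, simp add: M_basic)

lemma M_mult_Suc: "(x + 1) * y = x * y + (y :: M)"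
proof (rule delta0_induct[where Q = "\<lambda>y. (x + 1) * y = x * y + y"])
  show "(x + 1) * (y + 1) = x * (y + 1) + (y + 1)" if "(x + 1) * y = x * y + y" for y
    using that by (simp add: M_basic(4,6)) (metis M_add_assoc M_add_comm)
qed (intro delta0_intros, simp add: M_basic)

lemma M_mult_comm: "x * y = y * (x :: M)"
proof (rule delta0_induct[where Q = "\<lambda>y. x * y = y * x"])
  show "x * (y + 1) = (y + 1) * x" if "x * y = y * x" for y
    using that by (simp add: M_basic M_mult_Suc)
qed (intro delta0_intros, simp add: M_basic M_mult_0)

lemma M_mult_1: "1 * x = (x :: M)"
  using M_basic(6)[of x 0] M_mult_comm[of 1 x] by (simp add: M_basic M_add_0)

lemma M_add_cancel: "x + z = y + z \<longleftrightarrow> x = (y :: M)"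
proof -
  have "x + z = y + z \<longrightarrow> x = y"
  proof (rule delta0_induct[where Q = "\<lambda>z. x + z = y + z \<longrightarrow> x = y"])
    show "x + (z + 1) = y + (z + 1) \<longrightarrow> x = y" if "x + z = y + z \<longrightarrow> x = y" for z
      using that M_basic(2) by (auto simp: M_basic(4))
  qed (intro delta0_intros, simp add: M_basic)
  then show ?thesis by blast
qed

text \<open>Bounding the predecessor by \<open>x\<close> keeps the induction formula bounded. The
  witness in the proof of \<open>M_less_iff\<close> is bounded for the same reason.\<close>

lemma M_zero_or_Suc: "x = 0 \<or> (\<exists>y. x = y + (1 :: M))"
proof -
  have "x = 0 \<or> (\<exists>y<x. x = y + 1)"
  proof (rule delta0_induct[where Q = "\<lambda>x. x = 0 \<or> (\<exists>y<x. x = y + 1)"])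
    show "delta0 (Suc (Suc 0)) (\<lambda>e. e (Suc 0) = 0 \<or> (\<exists>y<e (Suc 0). e (Suc 0) = y + 1))"
      by (intro delta0_intros)
  qed (auto simp: M_basic)
  then show ?thesis by blast
qed

lemma M_Suc_mono: "c < y \<Longrightarrow> c + 1 < y + (1 :: M)"
proof -
  have "c < y \<longrightarrow> c + 1 < y + 1"
  proof (rule delta0_induct[where Q = "\<lambda>y. c < y \<longrightarrow> c + 1 < y + 1"])
    show "delta0 (Suc (Suc 0)) (\<lambda>e. c < e (Suc 0) \<longrightarrow> c + 1 < e (Suc 0) + 1)"
      by (intro delta0_intros)
  qed (auto simp: M_basic)
  then show "c < y \<Longrightarrow> c + 1 < y + 1" by blast
qed

lemma M_zero_less_Suc: "0 < y + (1 :: M)"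
proof (rule delta0_induct[where Q = "\<lambda>y. 0 < y + 1"])
  show "delta0 (Suc (Suc 0)) (\<lambda>e. 0 < e (Suc 0) + 1)" by (intro delta0_intros)
qed (auto simp: M_basic)

lemma M_less_iff: "x < y \<longleftrightarrow> (\<exists>c. y = x + c + (1 :: M))"
proof
  have "x < y \<longrightarrow> (\<exists>c<y. y = x + c + 1)"
  proof (rule delta0_induct[where Q = "\<lambda>y. x < y \<longrightarrow> (\<exists>c<y. y = x + c + 1)"])
    show "delta0 (Suc (Suc 0)) (\<lambda>e. x < e (Suc 0) \<longrightarrow> (\<exists>c<e (Suc 0). e (Suc 0) = x + c + 1))"
      by (intro delta0_intros)
    show "x < 0 \<longrightarrow> (\<exists>c<0. 0 = x + c + 1)" by (simp add: M_basic)
    show "x < y + 1 \<longrightarrow> (\<exists>c<y + 1. y + 1 = x + c + 1)" if IH: "x < y \<longrightarrow> (\<exists>c<y. y = x + c + 1)" for y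
    proof
      assume "x < y + 1"
      then consider "x < y" | "x = y" by (auto simp: M_basic)
      then show "\<exists>c<y + 1. y + 1 = x + c + 1"
      proof cases
        case 1
        then obtain c where "c < y" "y = x + c + 1" using IH by blast
        then have "c + 1 < y + 1" "y + 1 = x + (c + 1) + 1" using M_Suc_mono by (auto simp: M_basic)
        then show ?thesis by blast
      next
        case 2
        then show ?thesis using M_zero_less_Suc M_basic(3) by metis
      qed
    qed
  qed
  then show "x < y \<Longrightarrow> \<exists>c. y = x + c + 1" by blast
next
  have "x < x + c + 1" for c
  proof (rule delta0_induct[where Q = "\<lambda>c. x < x + c + 1"])
    show "delta0 (Suc (Suc 0)) (\<lambda>e. x < x + e (Suc 0) + 1)" by (intro delta0_intros)
  qed (auto simp: M_basic)
  then show "\<exists>c. y = x + c + 1 \<Longrightarrow> x < y" by blast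
qed

lemma M_not_less_self: "\<not> x < (x :: M)"
proof
  assume "x < x"
  then obtain c where "x = x + c + 1" by (auto simp: M_less_iff)
  then have "0 + x = (c + 1) + x" by (metis M_add_0 M_add_assoc M_add_comm)
  then show False using M_basic(1) M_add_cancel by metis
qed

lemma M_less_trans: "x < y \<Longrightarrow> y < z \<Longrightarrow> x < (z :: M)"
  by (auto simp: M_less_iff) (metis M_add_assoc)

lemma M_less_linear: "x < y \<or> x = y \<or> y < (x :: M)"
proof (rule delta0_induct[where Q = "\<lambda>y. x < y \<or> x = y \<or> y < x"])
  show "delta0 (Suc (Suc 0)) (\<lambda>e. x < e (Suc 0) \<or> x = e (Suc 0) \<or> e (Suc 0) < x)"
    by (intro delta0_intros)
  show "x < 0 \<or> x = 0 \<or> 0 < x" using M_zero_or_Suc[of x] M_zero_less_Suc by auto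
  show "x < y + 1 \<or> x = y + 1 \<or> y + 1 < x" if IH: "x < y \<or> x = y \<or> y < x" for y
  proof -
    consider "x < y \<or> x = y" | c where "x = y + c + 1" using IH unfolding M_less_iff[of y x] by fast
    then show ?thesis
    proof cases
      case 1
      then show ?thesis by (auto simp: M_basic)
    next
      case 2
      consider "c = 0" | d where "c = d + 1" using M_zero_or_Suc by blast
      then show ?thesis
      proof cases
        case 1
        then show ?thesis using 2 by (simp add: M_basic)
      next
        case d: 2
        then have "x = (y + 1) + d + 1" using 2 by (metis M_add_assoc M_add_comm)
        then show ?thesis by (auto simp: M_less_iff)
      qed
    qed
  qed
qed

lemma M_le_iff: "x \<le> y \<longleftrightarrow> (\<exists>c. y = x + (c :: M))"
proof
  show "x \<le> y \<Longrightarrow> \<exists>c. y = x + c"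
    unfolding less_eq_M_def M_less_iff by (metis M_add_assoc M_basic(3))
  show "\<exists>c. y = x + c \<Longrightarrow> x \<le> y"
    unfolding less_eq_M_def M_less_iff using M_zero_or_Suc by (metis M_basic(3,4))
qed

instantiation M :: linordered_semidom
begin

text \<open>The type class prescribes truncated subtraction; with it the general theory of ordered
  semirings applies to the model.\<close>

definition minus_M :: "M \<Rightarrow> M \<Rightarrow> M" where
  "minus_M x y = (if y \<le> x then THE c. x = y + c else 0)"

lemma M_add_diff: "(y + c) - y = (c :: M)"
proof -
  have "y \<le> y + c" by (auto simp: M_le_iff)
  moreover have "(THE d. y + c = y + d) = c"
    by (rule the_equality) (metis M_add_cancel M_add_comm)+
  ultimately show ?thesis by (simp add: minus_M_def)
qed

lemma M_diff_add: "x - (x + z) = (0 :: M)"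
proof (cases "x + z \<le> x")
  case True
  then obtain c where "x = x + z + c" by (auto simp: M_le_iff)
  then have "z + c = 0" by (metis M_add_0 M_add_assoc M_add_cancel M_add_comm)
  then have "z = 0" using M_zero_or_Suc[of c] M_basic(1,3,4) by metis
  then show ?thesis using M_add_diff[of x 0] by (simp add: M_basic)
qed (simp add: minus_M_def)

instance
proof
  fix a b c :: M
  show "a + b + c = a + (b + c)" by (rule M_add_assoc)
  show "a + b = b + a" by (rule M_add_comm)
  show "0 + a = a" by (rule M_add_0)
  show "a * b * c = a * (b * c)" by (rule M_mult_assoc)
  show "a * b = b * a" by (rule M_mult_comm)
  show "1 * a = a" by (rule M_mult_1)
  show "(a + b) * c = a * c + b * c" by (metis M_distrib M_mult_comm)
  show dist: "a * (b + c) = a * b + a * c" for a b c :: M by (rule M_distrib)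
  show "a * (b - c) = a * b - a * c"
  proof (cases "c \<le> b")
    case True
    then show ?thesis by (auto simp: M_le_iff dist M_add_diff)
  next
    case False
    then have "b \<le> c" unfolding less_eq_M_def using M_less_linear[of b c] by auto
    then obtain d where "c = b + d" by (auto simp: M_le_iff)
    then show ?thesis by (simp add: dist M_diff_add M_basic)
  qed
  show "0 * a = 0" by (rule M_mult_0)
  show "a * 0 = 0" by (rule M_basic)
  show "(0::M) \<noteq> 1" using M_basic(1)[of 0] by (simp add: M_add_0)
  show "a + b - a = b" by (rule M_add_diff)
  show "a - b - c = a - (b + c)"
  proof (cases "b + c \<le> a")
    case True
    then obtain d where "a = b + c + d" by (auto simp: M_le_iff)
    then show ?thesis by (metis M_add_assoc M_add_diff)
  next
    case False
    show ?thesis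
    proof (cases "b \<le> a")
      case True
      then obtain d where d: "a = b + d" by (auto simp: M_le_iff)
      then have "\<not> c \<le> d" using False by (auto simp: M_le_iff M_add_assoc)
      then show ?thesis using False d by (simp add: minus_M_def[of d c] minus_M_def[of "b + d" "b + c"] M_add_diff)
    next
      case b: False
      have "0 - c = 0" using M_diff_add[of 0 c] by (simp add: M_add_0)
      then show ?thesis using False b by (simp add: minus_M_def[of a b] minus_M_def[of a "b + c"])
    qed
  qed
  show "a < b \<longleftrightarrow> a \<le> b \<and> \<not> b \<le> a"
    unfolding less_eq_M_def using M_not_less_self[of a] M_less_trans[of a b a] by auto
  show "a \<le> a" by (simp add: less_eq_M_def)
  show "a \<le> b \<Longrightarrow> b \<le> c \<Longrightarrow> a \<le> c" unfolding less_eq_M_def using M_less_trans by blast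
  show "a \<le> b \<Longrightarrow> b \<le> a \<Longrightarrow> a = b"
    unfolding less_eq_M_def using M_not_less_self[of a] M_less_trans[of a b a] by auto
  show "a \<le> b \<or> b \<le> a" unfolding less_eq_M_def using M_less_linear[of a b] by auto
  show "a \<le> b \<Longrightarrow> c + a \<le> c + b" by (auto simp: M_le_iff) (metis M_add_assoc)
  show "a < b \<Longrightarrow> 0 < c \<Longrightarrow> c * a < c * b"
  proof -
    assume "a < b" "0 < c"
    then obtain d e where d: "b = a + d + 1" and e: "c = e + 1"
      by (auto simp: M_less_iff M_add_0)
    have "c * b = c * a + c * d + c" by (simp only: d M_basic(6)[of c "a + d"] M_distrib[of c a d])
    also have "\<dots> = c * a + (c * d + e) + 1" by (subst (3) e) (simp only: M_add_assoc)
    finally have "c * b = c * a + (c * d + e) + 1" .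
    then show "c * a < c * b" by (auto simp: M_less_iff)
  qed
  show "a \<noteq> 0 \<Longrightarrow> b \<noteq> 0 \<Longrightarrow> a * b \<noteq> 0"
    using M_zero_or_Suc[of a] M_zero_or_Suc[of b] by (auto simp: M_basic)
  show "(0::M) < 1" using M_zero_less_Suc[of 0] by (simp add: M_add_0)
  show "b \<le> a \<Longrightarrow> a - b + b = a" by (metis M_add_comm M_add_diff M_le_iff)
qed

end

lemma less_Suc_iff [simp]: "x < y + 1 \<longleftrightarrow> x \<le> (y :: M)"
  by (auto simp: M_basic less_eq_M_def)

lemma zero_le [simp]: "0 \<le> (x :: M)"
  by (metis less_Suc_iff M_zero_less_Suc)

lemma Suc_cases: obtains "x = 0" | y where "x = y + (1 :: M)"
  using M_zero_or_Suc by blast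

lemma not_less_zero [simp]: "\<not> x < (0 :: M)"
  by (simp add: not_less)

lemma Suc_le_iff: "x + 1 \<le> y \<longleftrightarrow> x < (y :: M)"
  by (metis add_le_cancel_right less_Suc_iff not_le)

text \<open>Without a least element, induction on \<open>x\<close> shows that nothing below
  \<open>x\<close> satisfies \<open>Q\<close>. The three slots belong to the bounded variable, the
  dummy witness and the induction variable.\<close>

lemma delta0_least:
  assumes Q: "delta0 (Suc (Suc (Suc 0))) (\<lambda>e. Q (e 0))" and "Q a"
  shows "\<exists>x. Q x \<and> (\<forall>y<x. \<not> Q y)"
proof (rule ccontr)
  assume *: "\<not> ?thesis"
  have "\<forall>y<x. \<not> Q y" for x
  proof (rule delta0_induct[where Q = "\<lambda>x. \<forall>y<x. \<not> Q y"])
    show "delta0 (Suc (Suc 0)) (\<lambda>e. \<forall>y<e (Suc 0). \<not> Q y)"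
      by (intro delta0_intros Q)
    show "\<forall>y<x + 1. \<not> Q y" if "\<forall>y<x. \<not> Q y" for x
      using that * by (auto simp: le_less)
  qed simp
  then show False using \<open>Q a\<close> by (metis less_Suc_iff order_refl)
qed

lemma delta0_less_induct:
  assumes Q: "delta0 (Suc (Suc (Suc 0))) (\<lambda>e. Q (e 0))" and "\<And>x. (\<And>y. y < x \<Longrightarrow> Q y) \<Longrightarrow> Q x"
  shows "Q a"
proof (rule ccontr)
  assume "\<not> Q a"
  from delta0_least[OF delta0_not[OF Q] this] show False using assms(2) by blast
qed


section \<open>Coding finite sets\<close>

lemma tfun_shift: "tfun d f \<Longrightarrow> tfun (Suc d) (\<lambda>e. f (\<lambda>i. e (Suc i)))"
proof -
  assume "tfun d f"
  then obtain t where t: "\<And>e. \<forall>i. e (i + d) = base i \<Longrightarrow> f e = eval e t"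
    unfolding tfun_def by blast
  have "f (\<lambda>i. e (Suc i)) = eval e (tshift t)" if "\<forall>i. e (i + Suc d) = base i" for e
    using t[of "\<lambda>i. e (Suc i)"] that by (simp add: tshift_def eval_tsubst)
  then show ?thesis unfolding tfun_def by blast
qed

lemma dvd_bounded: "a dvd c \<longleftrightarrow> (\<exists>q<c + 1. c = a * (q :: M))"
proof
  assume "a dvd c"
  then obtain q where q: "c = a * q" by (auto elim: dvdE)
  show "\<exists>q<c + 1. c = a * q"
  proof (cases "a = 0")
    case True
    \<comment> \<open>Here also \<open>c = 0\<close>, but the given quotient may be large, so it is
      replaced by 0.\<close>
    then show ?thesis using q by (intro exI[of _ 0]) simp
  next
    case False
    then have "1 \<le> a" using Suc_le_iff[of 0 a] by (simp add: order_less_le)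
    then have "1 * q \<le> a * q" by (intro mult_right_mono) simp_all
    then show ?thesis using q by auto
  qed
qed auto

lemma delta0_dvd: "tfun d f \<Longrightarrow> tfun d g \<Longrightarrow> delta0 d (\<lambda>e. f e dvd g e)"
  unfolding dvd_bounded by (intro delta0_intros tfun_shift)

section \<open>Pairing\<close>

definition pr :: "M \<Rightarrow> M \<Rightarrow> M" where
  "pr x y = (x + y) * (x + y) + x"

lemma tfun_pr: "tfun d f \<Longrightarrow> tfun d g \<Longrightarrow> tfun d (\<lambda>e. pr (f e) (g e))"
  unfolding pr_def by (intro delta0_intros)

text \<open>\<open>pr x y\<close> is at least (x + y)^2 and less than (x + y + 1)^2, so it
  determines the sum of the components.\<close>

lemma pr_sum_mono: "pr x y = pr x' y' \<Longrightarrow> x' + y' \<le> x + y"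
proof (rule ccontr)
  assume eq: "pr x y = pr x' y'" and "\<not> x' + y' \<le> x + y"
  then have "x + y + 1 \<le> x' + y'" by (simp add: Suc_le_iff)
  then have "(x + y + 1) * (x + y + 1) \<le> (x' + y') * (x' + y')" by (intro mult_mono) simp_all
  also have "\<dots> \<le> pr x y" unfolding eq by (simp add: pr_def)
  finally have "(x + y + 1) * (x + y + 1) \<le> (x + y) * (x + y) + x" by (simp add: pr_def)
  moreover have "(x + y + 1) * (x + y + 1) = (x + y) * (x + y) + x + (x + y + y + 1)"
    by (simp add: algebra_simps)
  ultimately show False by (simp add: Suc_le_iff)
qed

lemma pr_inject [simp]: "pr x y = pr x' y' \<longleftrightarrow> x = x' \<and> y = y'"
proof
  assume eq: "pr x y = pr x' y'"
  then have "x + y = x' + y'" using pr_sum_mono by (metis order_antisym)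
  moreover from this have "x = x'" using eq by (simp add: pr_def)
  ultimately show "x = x' \<and> y = y'" by simp
qed simp

lemma pr_mono: "x \<le> x' \<Longrightarrow> y \<le> y' \<Longrightarrow> pr x y \<le> pr x' y'"
  unfolding pr_def by (intro add_mono mult_mono) simp_all

lemma le_square: "x \<le> x * (x :: M)"
proof (cases "x = 0")
  case False
  then have "1 \<le> x" using Suc_le_iff[of 0 x] by (simp add: order_less_le)
  then have "1 * x \<le> x * x" by (intro mult_right_mono) simp_all
  then show ?thesis by simp
qed simp

text \<open>Thanks to these bounds a pair is decoded by bounded quantifiers.\<close>

lemma le_pr: "x \<le> pr x y" "y \<le> pr x y"
proof -
  show "x \<le> pr x y" by (simp add: pr_def)
  have "y \<le> x + y" by simp
  also have "\<dots> \<le> (x + y) * (x + y)" by (rule le_square)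
  also have "\<dots> \<le> pr x y" by (simp add: pr_def)
  finally show "y \<le> pr x y" .
qed

text \<open>
  A number codes a finite set by divisibility, as in Goedel's beta function, but the pairwise
  coprimality of the moduli \<open>1 + (i + 1) m\<close> is used only in the form of \<open>modulus_cancel\<close>, which
  needs no theory of coprimality.
\<close>

definition modulus :: "M \<Rightarrow> M \<Rightarrow> M" where
  "modulus m i = 1 + (i + 1) * m"

definition memc :: "M \<Rightarrow> M \<Rightarrow> bool" where
  "memc i s \<longleftrightarrow> (\<exists>m<s + 1. \<exists>c<s + 1. s = pr m c \<and> modulus m i dvd c)"

lemma tfun_modulus: "tfun d f \<Longrightarrow> tfun d g \<Longrightarrow> tfun d (\<lambda>e. modulus (f e) (g e))"
  unfolding modulus_def by (intro delta0_intros)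

lemma delta0_memc: "tfun d f \<Longrightarrow> tfun d g \<Longrightarrow> delta0 d (\<lambda>e. memc (f e) (g e))"
  unfolding memc_def by (intro delta0_intros delta0_dvd tfun_pr tfun_modulus tfun_shift)

lemma memc_pr [simp]: "memc i (pr m c) \<longleftrightarrow> modulus m i dvd c"
  by (auto simp: memc_def le_pr)

text \<open>The modulus is congruent to 1 modulo \<open>m\<close>, so \<open>modulus m i * y\<close>
  differs from \<open>y\<close> by a multiple of \<open>m * y\<close>.\<close>

lemma modulus_cancel_left:
  assumes "modulus m i dvd m * y" shows "modulus m i dvd y"
proof -
  have "modulus m i dvd (i + 1) * (m * y)" using assms by (rule dvd_mult)
  moreover have "modulus m i * y = y + (i + 1) * (m * y)"
    by (simp add: modulus_def algebra_simps)
  ultimately show ?thesis by (metis dvd_add_left_iff dvd_triv_left)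
qed

text \<open>The two moduli differ by \<open>(d + 1) * m\<close>, where \<open>d + 1\<close> is the
  distance of the indices, so \<open>modulus m i\<close> divides \<open>(d + 1) * m * c\<close>. As
  \<open>d + 1\<close> divides \<open>m\<close>, it divides \<open>m * (m * c)\<close>, and
  \<open>m\<close> can be cancelled twice.\<close>

lemma modulus_cancel:
  assumes "i \<noteq> j" "\<And>d. i = j + d + 1 \<or> j = i + d + 1 \<Longrightarrow> d + 1 dvd m"
    and dvd: "modulus m i dvd modulus m j * c"
  shows "modulus m i dvd c"
proof -
  have "\<exists>d. i = j + d + 1 \<or> j = i + d + 1"
    unfolding ex_disj_distrib M_less_iff[symmetric] using assms(1) by (simp add: neq_iff disj_commute)
  then obtain d where d: "i = j + d + 1 \<or> j = i + d + 1" ..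
  have *: "modulus m i dvd (d + 1) * m * c"
  proof (cases "i = j + d + 1")
    case True
    then have "modulus m i * c = modulus m j * c + (d + 1) * m * c"
      by (simp add: modulus_def algebra_simps)
    then have "modulus m i dvd modulus m j * c + (d + 1) * m * c"
      using dvd_triv_left[of "modulus m i" c] by (simp only:)
    then show ?thesis by (simp only: dvd_add_right_iff[OF dvd])
  next
    case False
    then have eq: "modulus m j * c = modulus m i * c + (d + 1) * m * c"
      using d by (simp add: modulus_def algebra_simps)
    show ?thesis using dvd unfolding eq by (simp only: dvd_add_right_iff[OF dvd_triv_left])
  qed
  obtain t where t: "m = (d + 1) * t" using assms(2)[OF d] by (rule dvdE)
  have eq: "m * (m * c) = ((d + 1) * m * c) * t" by (subst (1) t) (simp only: ac_simps)
  have "modulus m i dvd m * (m * c)" unfolding eq by (rule dvd_mult2[OF *])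
  then show ?thesis by (rule modulus_cancel_left[OF modulus_cancel_left])
qed

lemma modulus_not_dvd_1:
  assumes "0 < m" shows "\<not> modulus m i dvd 1"
proof
  assume "modulus m i dvd 1"
  then obtain q where q: "1 = modulus m i * q" by (auto elim: dvdE)
  then have "q \<noteq> 0" by auto
  then have "1 \<le> q" using Suc_le_iff[of 0 q] by (simp add: order_less_le)
  then have "modulus m i * 1 \<le> modulus m i * q"
    by (intro mult_left_mono) simp_all
  moreover have "1 < modulus m i"
    using assms by (simp add: modulus_def distrib_right add_nonneg_pos)
  ultimately show False using q by simp
qed

text \<open>No term denotes a factorial, so the multiple is built by Sigma01 induction, one factor
  at a time. Positivity excludes the trivial multiple 0.\<close>

lemma ex_common_multiple: "\<exists>m>0. \<forall>d<b. d + 1 dvd (m :: M)"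
proof (rule sigma1_induct[where Q = "\<lambda>m b. 0 < m \<and> (\<forall>d<b. d + 1 dvd m)"])
  show "delta0 (Suc (Suc 0)) (\<lambda>e. 0 < e 0 \<and> (\<forall>d<e (Suc 0). d + 1 dvd e 0))"
    by (intro delta0_intros delta0_dvd)
  show "\<exists>m>0. \<forall>d<0. d + 1 dvd (m :: M)" by (intro exI[of _ 1]) simp
  show "\<exists>m'>0. \<forall>d<b + 1. d + 1 dvd m'" if m: "0 < m \<and> (\<forall>d<b. d + 1 dvd m)" for b m :: M
  proof (intro exI[of _ "m * (b + 1)"] conjI allI impI)
    show "0 < m * (b + 1)" using m by (simp add: add_nonneg_pos)
    show "d + 1 dvd m * (b + 1)" if "d < b + 1" for d
      using m that by (auto simp: le_less dvd_mult2)
  qed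
qed

context rca
begin

lemma ex_code:
  assumes "X \<in> Sets" shows "\<exists>s. \<forall>i<b. memc i s \<longleftrightarrow> i \<in> X"
proof -
  obtain m where m: "0 < m" "\<And>d. d < b \<Longrightarrow> d + 1 dvd m" using ex_common_multiple by blast
  \<comment> \<open>\<open>c\<close> is the product of the moduli of the members below
    \<open>j\<close> and \<open>b\<close>, starting from 1, which no modulus divides because
    \<open>m\<close> is positive.\<close>
  have "\<exists>c. \<forall>i<b. modulus m i dvd c \<longleftrightarrow> i \<in> X \<and> i < j" for j
  proof (rule sigma1_induct[where Q = "\<lambda>c j. \<forall>i<b. modulus m i dvd c \<longleftrightarrow> i \<in> X \<and> i < j"])
    show "delta0 (Suc (Suc 0)) (\<lambda>e. \<forall>i<b. modulus m i dvd e 0 \<longleftrightarrow> i \<in> X \<and> i < e (Suc 0))"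
      by (intro delta0_intros delta0_dvd tfun_modulus assms)
    show "\<exists>c. \<forall>i<b. modulus m i dvd c \<longleftrightarrow> i \<in> X \<and> i < 0"
      using modulus_not_dvd_1[OF m(1)] by (intro exI[of _ 1]) simp
    show "\<exists>c. \<forall>i<b. modulus m i dvd c \<longleftrightarrow> i \<in> X \<and> i < j + 1"
      if c: "\<forall>i<b. modulus m i dvd c \<longleftrightarrow> i \<in> X \<and> i < j" for c j
    proof (cases "j < b \<and> j \<in> X")
      case True
      have "modulus m i dvd modulus m j * c \<longleftrightarrow> i \<in> X \<and> i < j + 1" if "i < b" for i
      proof (cases "i = j")
        case True
        then show ?thesis using \<open>j < b \<and> j \<in> X\<close> by simp
      next
        case False
        have "d + 1 dvd m" if "i = j + d + 1 \<or> j = i + d + 1" for d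
        proof (rule m(2))
          have "d + 1 \<le> j + d + 1" "d + 1 \<le> i + d + 1" by simp_all
          moreover have "d < d + 1" by simp
          ultimately show "d < b"
            using that \<open>i < b\<close> True by (metis order_less_le_trans order_less_trans)
        qed
        then have "modulus m i dvd modulus m j * c \<longleftrightarrow> modulus m i dvd c"
          using modulus_cancel[OF False, of m c] by (auto simp: dvd_mult)
        then show ?thesis using c that False by (auto simp: le_less)
      qed
      then show ?thesis by blast
    next
      case False
      then show ?thesis using c by (intro exI[of _ c]) (auto simp: le_less)
    qed
  qed
  then obtain c where "\<forall>i<b. modulus m i dvd c \<longleftrightarrow> i \<in> X \<and> i < b" by blast
  then have "\<forall>i<b. memc i (pr m c) \<longleftrightarrow> i \<in> X" by simp
  then show ?thesis ..
qed

text \<open>Course-of-values recursion: \<open>R\<close> decides about \<open>y\<close> from a code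
  of the part below \<open>y\<close>. Correct initial segments exist by Sigma01 induction and agree
  by bounded induction. Thus to lie in some correct segment and to be left out by some correct
  segment are complementary Sigma01 conditions, and the set is Delta01.\<close>

theorem set_recursion:
  assumes delta0: "\<And>d f g. tfun d f \<Longrightarrow> tfun d g \<Longrightarrow> delta0 d (\<lambda>e. R (f e) (g e))"
    and local: "\<And>y s s'. \<forall>i<y. memc i s \<longleftrightarrow> memc i s' \<Longrightarrow> R y s \<longleftrightarrow> R y s'"
  shows "\<exists>A\<in>Sets. \<forall>y. \<exists>s. (\<forall>i<y. memc i s \<longleftrightarrow> i \<in> A) \<and> (y \<in> A \<longleftrightarrow> R y s)"
proof -
  define good where "good b s \<longleftrightarrow> (\<forall>y<b. memc y s \<longleftrightarrow> R y s)" for b s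
  have good_delta0: "delta0 d (\<lambda>e. good (f e) (g e))" if "tfun d f" "tfun d g" for d f g
    unfolding good_def by (intro delta0_intros delta0_memc delta0 tfun_shift that)
  have ex: "\<exists>s. good b s" for b
  proof (rule sigma1_induct[where Q = "\<lambda>s b. good b s"])
    show "delta0 (Suc (Suc 0)) (\<lambda>e. good (e (Suc 0)) (e 0))"
      by (intro good_delta0 delta0_intros)
    show "\<exists>s. good 0 s" by (simp add: good_def)
    show "\<exists>s. good (b + 1) s" if s: "good b s" for b s
    proof -
      \<comment> \<open>The longer segment is first formed as a set, where appending
        \<open>b\<close> is a definition by cases, and only then coded by a number.\<close>
      have "\<exists>X\<in>Sets. \<forall>i. i \<in> X \<longleftrightarrow> i < b \<and> memc i s \<or> i = b \<and> R b s"
        by (intro delta0_comprehension delta0_intros delta0_memc delta0)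
      then obtain X where X: "X \<in> Sets" "\<And>i. i \<in> X \<longleftrightarrow> i < b \<and> memc i s \<or> i = b \<and> R b s"
        by blast
      obtain s' where s': "\<And>i. i < b + 1 \<Longrightarrow> memc i s' \<longleftrightarrow> i \<in> X"
        using ex_code[OF X(1), of "b + 1"] by blast
      have "memc i s \<longleftrightarrow> memc i s'" if "i < b" for i
        using s'[of i] that X(2) by auto
      then have R: "R y s \<longleftrightarrow> R y s'" if "y \<le> b" for y
        using that by (intro local) auto
      have "memc y s' \<longleftrightarrow> R y s'" if "y < b + 1" for y
        using s'[of y] s X(2) R[of y] that by (auto simp: good_def le_less)
      then have "good (b + 1) s'" by (simp add: good_def)
      then show ?thesis ..
    qed
  qed
  have unique: "memc y s \<longleftrightarrow> memc y s'" if "good b s" "good b s'" "y < b" for b s s' y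
  proof -
    have "y < b \<longrightarrow> (memc y s \<longleftrightarrow> memc y s')"
    proof (rule delta0_less_induct[where Q = "\<lambda>y. y < b \<longrightarrow> (memc y s \<longleftrightarrow> memc y s')"])
      show "delta0 (Suc (Suc (Suc 0))) (\<lambda>e. e 0 < b \<longrightarrow> (memc (e 0) s \<longleftrightarrow> memc (e 0) s'))"
        by (intro delta0_intros delta0_memc)
      show "y < b \<longrightarrow> (memc y s \<longleftrightarrow> memc y s')"
        if "\<And>x. x < y \<Longrightarrow> x < b \<longrightarrow> (memc x s \<longleftrightarrow> memc x s')" for y
        using that local[of y s s'] \<open>good b s\<close> \<open>good b s'\<close>
        unfolding good_def by (meson order_less_trans)
    qed
    then show ?thesis using that(3) by blast
  qed
  have "\<exists>A\<in>Sets. \<forall>y. y \<in> A \<longleftrightarrow> (\<exists>s. good (y + 1) s \<and> memc y s)"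
  proof (rule delta1_comprehension[where P = "\<lambda>s y. good (y + 1) s \<and> memc y s"
        and Q = "\<lambda>s y. good (y + 1) s \<and> \<not> memc y s"])
    fix y
    obtain s where s: "good (y + 1) s" using ex by blast
    have "memc y s' \<longleftrightarrow> memc y s" if "good (y + 1) s'" for s'
      using unique[OF that s, of y] by simp
    then show "(\<exists>s. good (y + 1) s \<and> memc y s) \<longleftrightarrow> \<not> (\<exists>s. good (y + 1) s \<and> \<not> memc y s)"
      using s by metis
  qed (intro delta0_intros good_delta0 delta0_memc)+
  then obtain A where A: "A \<in> Sets" "\<And>y. y \<in> A \<longleftrightarrow> (\<exists>s. good (y + 1) s \<and> memc y s)" by blast
  have "(\<forall>i<y. memc i s \<longleftrightarrow> i \<in> A) \<and> (y \<in> A \<longleftrightarrow> R y s)" if s: "good (y + 1) s" for y s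
  proof -
    have "memc i s \<longleftrightarrow> i \<in> A" if "i \<le> y" for i
    proof -
      have "good (i + 1) s" using s that unfolding good_def by auto
      then have "memc i s' \<longleftrightarrow> memc i s" if "good (i + 1) s'" for s'
        using unique[OF that, of s i] by simp
      then show ?thesis unfolding A(2) using \<open>good (i + 1) s\<close> by metis
    qed
    moreover have "memc y s \<longleftrightarrow> R y s" using s by (simp add: good_def)
    ultimately show ?thesis by auto
  qed
  then show ?thesis using A(1) ex by metis
qed

end


section \<open>Coloring bounded graphs in the model\<close>

definition is_graph :: "M set \<Rightarrow> M set \<Rightarrow> bool" where
  "is_graph V E \<longleftrightarrow>
     (\<forall>e\<in>E. \<exists>x y. x \<in> V \<and> y \<in> V \<and> x \<noteq> y \<and> e = pr x y \<and> pr y x \<in> E)"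

definition is_function :: "M set \<Rightarrow> M set \<Rightarrow> bool" where
  "is_function F V \<longleftrightarrow> (\<forall>e\<in>F. \<exists>x u. x \<in> V \<and> e = pr x u) \<and> (\<forall>x\<in>V. \<exists>u. pr x u \<in> F)
     \<and> (\<forall>x u v. pr x u \<in> F \<and> pr x v \<in> F \<longrightarrow> u = v)"

definition is_coloring :: "M set \<Rightarrow> M set \<Rightarrow> M set \<Rightarrow> M \<Rightarrow> bool" where
  "is_coloring C V E k \<longleftrightarrow> is_function C V \<and> (\<forall>x u. pr x u \<in> C \<longrightarrow> u < k)
     \<and> (\<forall>x y. pr x y \<in> E \<longrightarrow> (\<forall>u. pr x u \<in> C \<longrightarrow> pr y u \<notin> C))"

lemmas delta0_closure = delta0_intros delta0_memc tfun_pr tfun_shift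

section \<open>Parity\<close>

definition evn :: "M \<Rightarrow> bool" where
  "evn y \<longleftrightarrow> (\<exists>q<y + 1. y = q + q)"

lemma evn_iff: "evn y \<longleftrightarrow> (\<exists>q. y = q + q)"
proof
  assume "\<exists>q. y = q + q"
  then obtain q where q: "y = q + q" ..
  then have "q < y + 1" by simp
  with q show "evn y" unfolding evn_def by blast
qed (auto simp: evn_def)

lemma delta0_evn: "tfun d f \<Longrightarrow> delta0 d (\<lambda>e. evn (f e))"
  unfolding evn_def by (intro delta0_closure)

lemma evn_or: "evn y \<or> evn (y + 1)"
proof (rule delta0_induct[where Q = "\<lambda>y. evn y \<or> evn (y + 1)"])
  show "delta0 (Suc (Suc 0)) (\<lambda>e. evn (e (Suc 0)) \<or> evn (e (Suc 0) + 1))"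
    by (intro delta0_closure delta0_evn)
  show "evn 0 \<or> evn (0 + 1)" unfolding evn_iff by (intro disjI1 exI[of _ 0]) simp
  show "evn (y + 1) \<or> evn (y + 1 + 1)" if y: "evn y \<or> evn (y + 1)" for y
  proof (cases "evn (y + 1)")
    case False
    then obtain q where "y = q + q" using y by (auto simp: evn_iff)
    then have "y + 1 + 1 = (q + 1) + (q + 1)" by (simp add: ac_simps)
    then show ?thesis unfolding evn_iff by blast
  qed simp
qed

lemma evn_Suc [simp]: "evn (y + 1) \<longleftrightarrow> \<not> evn y"
proof -
  have False if even: "evn y" "evn (y + 1)"
  proof -
    obtain q where y: "y = q + q" using even(1) unfolding evn_iff ..
    obtain r where r: "y + 1 = r + r" using even(2) unfolding evn_iff ..
    show False
    proof (cases "r \<le> q")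
      case True
      then have "r + r \<le> q + q" by (intro add_mono)
      then have "y + 1 \<le> y" unfolding y[symmetric] r[symmetric] .
      then show False by (simp add: Suc_le_iff)
    next
      case False
      then have "q + 1 \<le> r" by (simp add: Suc_le_iff)
      then have "(q + 1) + (q + 1) \<le> r + r" by (intro add_mono)
      moreover have "(q + 1) + (q + 1) = y + 1 + 1" by (simp add: y ac_simps)
      ultimately have "y + 1 + 1 \<le> y + 1" unfolding r[symmetric] by simp
      then show False by (simp only: Suc_le_iff order_less_irrefl)
    qed
  qed
  then show ?thesis using evn_or by blast
qed

text \<open>The graph of a total function with a Sigma01 definition is Delta01, since a pair is
  refuted by exhibiting a different value.\<close>

lemma (in rca) function_comprehension:
  assumes T: "\<And>d f g h. tfun d f \<Longrightarrow> tfun d g \<Longrightarrow> tfun d h \<Longrightarrow> delta0 d (\<lambda>e. T (f e) (g e) (h e))"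
    and V: "V \<in> Sets"
    and total: "\<And>x. x \<in> V \<Longrightarrow> \<exists>w j. T w x j"
    and unique: "\<And>x w j w' j'. T w x j \<Longrightarrow> T w' x j' \<Longrightarrow> j = j'"
  shows "\<exists>C\<in>Sets. \<forall>e. e \<in> C \<longleftrightarrow> (\<exists>x j w. e = pr x j \<and> x \<in> V \<and> T w x j)"
proof -
  define P where "P w e \<longleftrightarrow> (\<exists>x<e + 1. \<exists>j<e + 1. e = pr x j \<and> x \<in> V \<and> T w x j)" for w e
  \<comment> \<open>One \<open>w\<close> bounds both the different value and its witness, which
    leaves a single unbounded quantifier. Numbers that are not pairs with first component in
    \<open>V\<close> satisfy \<open>Q\<close> vacuously.\<close>
  define Q where "Q w e \<longleftrightarrow>
    (\<forall>x<e + 1. \<forall>j<e + 1. e = pr x j \<longrightarrow> x \<in> V \<longrightarrow> (\<exists>j'<w. j' \<noteq> j \<and> (\<exists>w'<w. T w' x j')))" for w e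
  have P_iff: "P w e \<longleftrightarrow> (\<exists>x j. e = pr x j \<and> x \<in> V \<and> T w x j)" for w e
    unfolding P_def by (auto simp: le_pr)
  have Q_iff: "Q w e \<longleftrightarrow>
    (\<forall>x j. e = pr x j \<longrightarrow> x \<in> V \<longrightarrow> (\<exists>j'<w. j' \<noteq> j \<and> (\<exists>w'<w. T w' x j')))" for w e
    unfolding Q_def by (auto simp: le_pr)
  have "\<exists>C\<in>Sets. \<forall>e. e \<in> C \<longleftrightarrow> (\<exists>w. P w e)"
  proof (rule delta1_comprehension[where P = P and Q = Q])
    show "delta0 (Suc (Suc 0)) (\<lambda>e. P (e 0) (e (Suc 0)))"
      unfolding P_def by (intro delta0_closure T V)
    show "delta0 (Suc (Suc 0)) (\<lambda>e. Q (e 0) (e (Suc 0)))"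
      unfolding Q_def by (intro delta0_closure T V)
    show "(\<exists>w. P w e) \<longleftrightarrow> \<not> (\<exists>w. Q w e)" for e
    proof
      assume "\<exists>w. P w e"
      then obtain x j w where w: "e = pr x j" "x \<in> V" "T w x j" by (auto simp: P_iff)
      have False if Q: "Q w' e" for w'
      proof -
        obtain j' w'' where "j' \<noteq> j" "T w'' x j'" using Q w(1,2) unfolding Q_iff by blast
        then show False using unique[OF w(3)] by blast
      qed
      then show "\<not> (\<exists>w. Q w e)" by blast
    next
      assume not_Q: "\<not> (\<exists>w. Q w e)"
      then obtain x j where e: "e = pr x j" "x \<in> V" unfolding Q_iff by blast
      then obtain w j' where w: "T w x j'" using total by blast
      have "j' = j"
      proof (rule ccontr)
        assume "j' \<noteq> j"
        moreover have "j' < j' + w + 1" "w < j' + w + 1" by simp_all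
        ultimately have "\<exists>i<j' + w + 1. i \<noteq> j \<and> (\<exists>w'<j' + w + 1. T w' x i)" using w by blast
        then have "Q (j' + w + 1) e" by (simp add: Q_iff e(1))
        then show False using not_Q by blast
      qed
      then have "T w x j" using w by simp
      then have "P w e" unfolding P_iff using e by blast
      then show "\<exists>w. P w e" ..
    qed
  qed
  moreover have "(\<exists>w. P w e) \<longleftrightarrow> (\<exists>x j w. e = pr x j \<and> x \<in> V \<and> T w x j)" for e
    unfolding P_iff by blast
  ultimately show ?thesis by (simp only:)
qed

locale bgraph = rca +
  fixes V E F :: "M set" and k :: M
  assumes Sets: "V \<in> Sets" "E \<in> Sets" "F \<in> Sets"
    and graph: "is_graph V E"
    and F: "is_function F V"
    and bound: "\<And>x y u. x \<in> V \<Longrightarrow> y \<in> V \<Longrightarrow> pr x y \<in> E \<Longrightarrow> pr x u \<in> F \<Longrightarrow> y \<le> u"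
    and local: "\<And>V' E' b. V' \<in> Sets \<Longrightarrow> E' \<in> Sets \<Longrightarrow> is_graph V' E' \<Longrightarrow> V' \<subseteq> V \<Longrightarrow> E' \<subseteq> E \<Longrightarrow>
      \<forall>x\<in>V'. x < b \<Longrightarrow> \<exists>C\<in>Sets. is_coloring C V' E' k"
begin

lemma edge: "pr x y \<in> E \<Longrightarrow> x \<in> V \<and> y \<in> V \<and> x \<noteq> y \<and> pr y x \<in> E"
  using graph unfolding is_graph_def by fastforce

section \<open>Cut points spaced by the bounding function\<close>

definition step :: "M \<Rightarrow> M \<Rightarrow> bool" where
  "step p q \<longleftrightarrow> p < q \<and> (\<forall>x<p. x \<in> V \<longrightarrow> (\<exists>u<q. pr x u \<in> F))"

lemma delta0_step: "tfun d f \<Longrightarrow> tfun d g \<Longrightarrow> delta0 d (\<lambda>e. step (f e) (g e))"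
  unfolding step_def by (intro delta0_closure Sets)

lemma step_edge: "step p q \<Longrightarrow> x < p \<Longrightarrow> pr x y \<in> E \<Longrightarrow> y < q"
  using bound edge unfolding step_def by (meson order_le_less_trans)

lemma step_mono: "step p q \<Longrightarrow> p' \<le> p \<Longrightarrow> q \<le> q' \<Longrightarrow> step p' q'"
  unfolding step_def by (meson order_le_less_trans order_less_le_trans)

text \<open>The bounding function is bounded on every initial segment. This instance of collection
  comes from Sigma01 induction, each new argument raising the bound by its value.\<close>

lemma ex_step: "\<exists>q. step p q"
proof (rule sigma1_induct[where Q = "\<lambda>q p. step p q"])
  show "delta0 (Suc (Suc 0)) (\<lambda>e. step (e (Suc 0)) (e 0))"
    by (intro delta0_closure delta0_step)
  show "\<exists>q. step 0 q" by (intro exI[of _ 1]) (simp add: step_def)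
  show "\<exists>q. step (p + 1) q" if q: "step p q" for p q
  proof -
    \<comment> \<open>For \<open>p\<close> outside \<open>V\<close> any \<open>u\<close> will
      do.\<close>
    obtain u where u: "p \<in> V \<Longrightarrow> pr p u \<in> F" using F unfolding is_function_def by blast
    have "q \<le> q + u + 1" by (simp add: add.assoc)
    then have q': "step p (q + u + 1)" using q step_mono by blast
    have "p + 1 \<le> q" using q by (simp add: step_def Suc_le_iff)
    also have "q < q + u + 1" by simp
    finally have "p + 1 < q + u + 1" .
    moreover have "\<exists>v<q + u + 1. pr x v \<in> F" if "x < p + 1" "x \<in> V" for x
    proof (cases "x = p")
      case True
      then show ?thesis using u that by (intro exI[of _ u]) auto
    next
      case False
      then show ?thesis using q' that unfolding step_def by (auto simp: le_less)
    qed
    ultimately have "step (p + 1) (q + u + 1)" unfolding step_def by blast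
    then show ?thesis ..
  qed
qed

text \<open>One step confines the neighbors of vertices below \<open>p\<close>, the second one the
  neighbors of these neighbors, which is what keeps recolored vertices away from the next
  block.\<close>

definition dstep :: "M \<Rightarrow> M \<Rightarrow> bool" where
  "dstep p r \<longleftrightarrow> (\<exists>q<r. step p q \<and> step q r)"

lemma delta0_dstep: "tfun d f \<Longrightarrow> tfun d g \<Longrightarrow> delta0 d (\<lambda>e. dstep (f e) (g e))"
  unfolding dstep_def by (intro delta0_closure delta0_step)

lemma ex_dstep: "\<exists>r. dstep p r"
  unfolding dstep_def using ex_step step_def by meson

lemma dstep_less: "dstep p r \<Longrightarrow> p < r"
  unfolding dstep_def step_def by (meson order_less_trans)

lemma dstep_mono: "dstep p r \<Longrightarrow> p' \<le> p \<Longrightarrow> r \<le> r' \<Longrightarrow> dstep p' r'"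
  unfolding dstep_def by (meson step_mono order_refl order_less_le_trans)

lemma dstep_edge: "dstep p r \<Longrightarrow> x < p \<Longrightarrow> pr x y \<in> E \<Longrightarrow> y < r"
  unfolding dstep_def using step_edge by (meson order_less_trans)

lemma dstep_edge2: "dstep p r \<Longrightarrow> x < p \<Longrightarrow> pr x y \<in> E \<Longrightarrow> pr y z \<in> E \<Longrightarrow> z < r"
  unfolding dstep_def using step_edge by meson

text \<open>The alternating parity of the cut points makes the number of a block modulo 2 definable.\<close>

definition is_cuts :: "M set \<Rightarrow> bool" where
  "is_cuts A \<longleftrightarrow> A \<in> Sets \<and> (\<forall>y. y \<in> A \<longleftrightarrow> (\<forall>p<y. p \<in> A \<longrightarrow>
     dstep p y \<and> ((\<forall>r<y. p < r \<longrightarrow> r \<notin> A) \<longrightarrow> (evn p \<longleftrightarrow> \<not> evn y))))"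

text \<open>The condition on \<open>y\<close> mentions only members of \<open>A\<close> below
  \<open>y\<close>, so \<open>A\<close> arises greedily: a number enters as soon as it is compatible
  with all earlier members.\<close>

lemma ex_cuts: "\<exists>A. is_cuts A"
proof -
  define R where "R y s \<longleftrightarrow> (\<forall>p<y. memc p s \<longrightarrow>
     dstep p y \<and> ((\<forall>r<y. p < r \<longrightarrow> \<not> memc r s) \<longrightarrow> (evn p \<longleftrightarrow> \<not> evn y)))" for y s
  have "\<exists>A\<in>Sets. \<forall>y. \<exists>s. (\<forall>i<y. memc i s \<longleftrightarrow> i \<in> A) \<and> (y \<in> A \<longleftrightarrow> R y s)"
  proof (rule set_recursion)
    show "delta0 d (\<lambda>e. R (f e) (g e))" if "tfun d f" "tfun d g" for d f g
      unfolding R_def by (intro delta0_closure delta0_dstep delta0_evn that)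
    show "R y s \<longleftrightarrow> R y s'" if "\<forall>i<y. memc i s \<longleftrightarrow> memc i s'" for y s s'
      unfolding R_def using that by simp
  qed
  then obtain A where A: "A \<in> Sets"
    "\<And>y. \<exists>s. (\<forall>i<y. memc i s \<longleftrightarrow> i \<in> A) \<and> (y \<in> A \<longleftrightarrow> R y s)" by blast
  have "y \<in> A \<longleftrightarrow> (\<forall>p<y. p \<in> A \<longrightarrow>
     dstep p y \<and> ((\<forall>r<y. p < r \<longrightarrow> r \<notin> A) \<longrightarrow> (evn p \<longleftrightarrow> \<not> evn y)))" for y
  proof -
    obtain s where "\<forall>i<y. memc i s \<longleftrightarrow> i \<in> A" "y \<in> A \<longleftrightarrow> R y s" using A(2) by blast
    then show ?thesis unfolding R_def by simp
  qed
  then show ?thesis using A(1) unfolding is_cuts_def by blast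
qed

section \<open>Least colorings of initial segments\<close>

definition colr :: "M \<Rightarrow> M \<Rightarrow> bool" where
  "colr b s \<longleftrightarrow> (\<forall>x<b. x \<in> V \<longrightarrow> (\<exists>i<k. memc (pr x i) s))
     \<and> (\<forall>x<b. \<forall>i<k. \<forall>j<k. memc (pr x i) s \<longrightarrow> memc (pr x j) s \<longrightarrow> i = j)
     \<and> (\<forall>x<b. \<forall>y<b. pr x y \<in> E \<longrightarrow> (\<forall>i<k. memc (pr x i) s \<longrightarrow> \<not> memc (pr y i) s))"

lemma delta0_colr: "tfun d f \<Longrightarrow> tfun d g \<Longrightarrow> delta0 d (\<lambda>e. colr (f e) (g e))"
  unfolding colr_def by (intro delta0_closure Sets)

text \<open>Local colorability applied to the subgraph below \<open>b\<close> yields a set. Coding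
  it turns colorings into numbers, among which there is a least one.\<close>

lemma ex_colr: "\<exists>s. colr b s"
proof -
  have "\<exists>V'\<in>Sets. \<forall>x. x \<in> V' \<longleftrightarrow> x \<in> V \<and> x < b"
    by (intro delta0_comprehension delta0_closure Sets)
  then obtain V' where V': "V' \<in> Sets" "\<And>x. x \<in> V' \<longleftrightarrow> x \<in> V \<and> x < b" by blast
  have "\<exists>E'\<in>Sets. \<forall>e. e \<in> E' \<longleftrightarrow> e \<in> E \<and> (\<exists>x<b. \<exists>y<b. e = pr x y)"
    by (intro delta0_comprehension delta0_closure Sets)
  then obtain E' where E': "E' \<in> Sets" "\<And>e. e \<in> E' \<longleftrightarrow> e \<in> E \<and> (\<exists>x<b. \<exists>y<b. e = pr x y)" by blast
  have "is_graph V' E'"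
    unfolding is_graph_def
  proof
    fix e assume "e \<in> E'"
    then obtain x y where xy: "x < b" "y < b" "e = pr x y" "e \<in> E" unfolding E'(2) by blast
    then have xy': "x \<in> V" "y \<in> V" "x \<noteq> y" "pr y x \<in> E" using edge[of x y] by simp_all
    moreover from this have "pr y x \<in> E'" unfolding E'(2) using xy(1,2) by blast
    ultimately have "x \<in> V'" "y \<in> V'" "x \<noteq> y" "pr y x \<in> E'" using xy(1,2) V'(2) by simp_all
    then show "\<exists>x y. x \<in> V' \<and> y \<in> V' \<and> x \<noteq> y \<and> e = pr x y \<and> pr y x \<in> E'" using xy(3) by blast
  qed
  moreover have "V' \<subseteq> V" "E' \<subseteq> E" "\<forall>x\<in>V'. x < b" by (auto simp: V'(2) E'(2))
  ultimately obtain C where C: "C \<in> Sets" "is_coloring C V' E' k"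
    using local[OF V'(1) E'(1), of b] by blast
  have C_total: "\<exists>u. pr x u \<in> C" if "x \<in> V'" for x
    using C(2) that unfolding is_coloring_def is_function_def by simp
  have C_fun: "u = v" if "pr x u \<in> C" "pr x v \<in> C" for x u v
    using C(2) that unfolding is_coloring_def is_function_def by simp
  have C_less: "u < k" if "pr x u \<in> C" for x u
    using C(2) that unfolding is_coloring_def by simp
  have C_edge: "\<not> pr y u \<in> C" if "pr x y \<in> E'" "pr x u \<in> C" for x y u
    using C(2) that unfolding is_coloring_def by blast
  \<comment> \<open>By monotonicity of pairing, all pairs of a vertex below \<open>b\<close> and a
    color below \<open>k\<close> are below this bound.\<close>
  obtain s where s: "\<And>i. i < pr b k + 1 \<Longrightarrow> memc i s \<longleftrightarrow> i \<in> C" using ex_code[OF C(1)] by blast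
  have mem: "memc (pr x i) s \<longleftrightarrow> pr x i \<in> C" if "x < b" "i < k" for x i
    using that by (intro s) (simp add: pr_mono)
  have "\<exists>i<k. memc (pr x i) s" if x: "x < b" "x \<in> V" for x
  proof -
    obtain i where i: "pr x i \<in> C" using C_total[of x] x V'(2) by blast
    then have "i < k" by (rule C_less)
    then show ?thesis using mem[OF x(1)] i by blast
  qed
  moreover have "i = j" if "x < b" "i < k" "j < k" "memc (pr x i) s" "memc (pr x j) s" for x i j
    using C_fun[of x i j] that by (simp add: mem)
  moreover have "\<not> memc (pr y i) s"
    if x: "x < b" "y < b" "pr x y \<in> E" "i < k" "memc (pr x i) s" for x y i
  proof -
    have "pr x y \<in> E'" unfolding E'(2) using x by blast
    then show ?thesis using C_edge[of x y i] x by (simp add: mem)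
  qed
  ultimately have "colr b s" unfolding colr_def by simp
  then show ?thesis ..
qed

text \<open>Minimality stands in for a choice function and is itself a bounded condition.\<close>

definition least_colr :: "M \<Rightarrow> M \<Rightarrow> bool" where
  "least_colr b s \<longleftrightarrow> colr b s \<and> (\<forall>t<s. \<not> colr b t)"

lemma delta0_least_colr: "tfun d f \<Longrightarrow> tfun d g \<Longrightarrow> delta0 d (\<lambda>e. least_colr (f e) (g e))"
  unfolding least_colr_def by (intro delta0_closure delta0_colr)

lemma ex_least_colr: "\<exists>s. least_colr b s"
proof -
  obtain s where "colr b s" using ex_colr by blast
  then have "\<exists>s. colr b s \<and> (\<forall>t<s. \<not> colr b t)"
    by (rule delta0_least[where Q = "colr b", rotated]) (intro delta0_closure delta0_colr)
  then show ?thesis unfolding least_colr_def .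
qed

lemma least_colr_unique: "least_colr b s \<Longrightarrow> least_colr b t \<Longrightarrow> s = t"
  unfolding least_colr_def by (cases s t rule: linorder_cases) auto

definition col :: "M \<Rightarrow> M \<Rightarrow> M \<Rightarrow> bool" where
  "col s x i \<longleftrightarrow> i < k \<and> memc (pr x i) s"

lemma delta0_col:
  "tfun d f \<Longrightarrow> tfun d g \<Longrightarrow> tfun d h \<Longrightarrow> delta0 d (\<lambda>e. col (f e) (g e) (h e))"
  unfolding col_def by (intro delta0_closure)

lemma ex_col: "least_colr b s \<Longrightarrow> x < b \<Longrightarrow> x \<in> V \<Longrightarrow> \<exists>i. col s x i"
  unfolding least_colr_def colr_def col_def by blast

lemma col_unique: "least_colr b s \<Longrightarrow> x < b \<Longrightarrow> col s x i \<Longrightarrow> col s x j \<Longrightarrow> i = j"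
  unfolding least_colr_def colr_def col_def by simp

lemma col_edge:
  "least_colr b s \<Longrightarrow> x < b \<Longrightarrow> y < b \<Longrightarrow> pr x y \<in> E \<Longrightarrow> col s x i \<Longrightarrow> \<not> col s y i"
  unfolding least_colr_def colr_def col_def by simp

text \<open>
  Two palettes of \<open>k\<close> colors that have only the color \<open>0\<close> in common: in the second one,
  color \<open>i > 0\<close> is represented by \<open>i + k - 1\<close>.
\<close>

definition palette :: "bool \<Rightarrow> M \<Rightarrow> M \<Rightarrow> bool" where
  "palette e i j \<longleftrightarrow> (e \<or> i = 0) \<and> j = i \<or> \<not> e \<and> i \<noteq> 0 \<and> j + 1 = i + k"

lemma ex_palette: "\<exists>j. palette e i j"
proof (cases i rule: Suc_cases)
  case 1
  then show ?thesis by (intro exI[of _ i]) (simp add: palette_def)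
next
  case (2 y)
  then have "y + k + 1 = i + k" by (simp add: ac_simps)
  then show ?thesis
    by (cases e) (auto simp: palette_def 2 intro: exI[of _ i] exI[of _ "y + k"])
qed

text \<open>The nonzero colors of the second palette lie beyond \<open>k - 1\<close>, so the
  palettes can meet only in 0.\<close>

lemma palette_ge: "i \<noteq> 0 \<Longrightarrow> j + 1 = i + k \<Longrightarrow> k \<le> j"
proof -
  assume "i \<noteq> 0" and j: "j + 1 = i + k"
  then have "1 \<le> i" using Suc_le_iff[of 0 i] by (simp add: order_less_le)
  then have "1 + k \<le> i + k" by (rule add_right_mono)
  then have "k + 1 \<le> j + 1" unfolding j by (simp only: add.commute[of k])
  then show "k \<le> j" by (simp only: add_le_cancel_right)
qed

lemma palette_inj: "palette e i j \<Longrightarrow> palette e i' j \<Longrightarrow> i < k \<Longrightarrow> i' < k \<Longrightarrow> i = i'"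
  using palette_ge[of i j] palette_ge[of i' j] add_right_cancel[of i k i']
  unfolding palette_def by (auto simp: not_less[symmetric])

lemma palette_fun: "palette e i j \<Longrightarrow> palette e i j' \<Longrightarrow> j = j'"
proof -
  have "j + 1 = i + k \<Longrightarrow> j' + 1 = i + k \<Longrightarrow> j = j'" by (metis add_right_cancel)
  then show "palette e i j \<Longrightarrow> palette e i j' \<Longrightarrow> j = j'" unfolding palette_def by auto
qed

lemma palette_disjoint:
  assumes "palette e i j" "palette (\<not> e) i' j" "i < k" "i' < k" shows "i = 0" "i' = 0"
  using assms palette_ge[of i j] palette_ge[of i' j]
  unfolding palette_def by (auto simp: not_less[symmetric])

text \<open>The largest possible color is (k - 1) + k - 1 = 2k - 2.\<close>

lemma palette_less:
  assumes "palette e i j" "i < k" "m + 1 = (1 + 1) * k" shows "j < m"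
proof -
  have "1 \<le> k" using assms(2) Suc_le_iff[of 0 k] by (metis add_0 order_le_less_trans zero_le)
  have "j + 1 < i + k + 1"
    using assms(1) \<open>1 \<le> k\<close> \<open>i < k\<close> unfolding palette_def by auto
  also have "i + k + 1 \<le> k + k" using \<open>i < k\<close> Suc_le_iff[of i k]
    by (metis add.assoc add.commute add_le_cancel_right)
  also have "k + k = m + 1" by (simp only: assms(3) distrib_right mult_1)
  finally show ?thesis by (simp add: Suc_le_iff)
qed

lemma delta0_palette:
  "delta0 d P \<Longrightarrow> tfun d f \<Longrightarrow> tfun d g \<Longrightarrow> delta0 d (\<lambda>e. palette (P e) (f e) (g e))"
  unfolding palette_def by (intro delta0_closure)

end

locale cuts = bgraph +
  fixes A :: "M set"
  assumes cuts: "is_cuts A"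
begin

lemma A_Sets: "A \<in> Sets"
  using cuts by (simp add: is_cuts_def)

lemma A_iff: "y \<in> A \<longleftrightarrow> (\<forall>p<y. p \<in> A \<longrightarrow>
     dstep p y \<and> ((\<forall>r<y. p < r \<longrightarrow> r \<notin> A) \<longrightarrow> (evn p \<longleftrightarrow> \<not> evn y)))"
  using cuts unfolding is_cuts_def by (elim conjE allE)

lemma zero_in_A: "0 \<in> A"
  by (subst A_iff) simp

definition nxt :: "M \<Rightarrow> M \<Rightarrow> bool" where
  "nxt p q \<longleftrightarrow> p \<in> A \<and> q \<in> A \<and> p < q \<and> (\<forall>r<q. p < r \<longrightarrow> r \<notin> A)"

lemma delta0_nxt: "tfun d f \<Longrightarrow> tfun d g \<Longrightarrow> delta0 d (\<lambda>e. nxt (f e) (g e))"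
  unfolding nxt_def by (intro delta0_closure A_Sets)

lemma A_dstep: "p \<in> A \<Longrightarrow> q \<in> A \<Longrightarrow> p < q \<Longrightarrow> dstep p q"
  using A_iff[of q] by simp

lemma nxt_parity: "nxt p q \<Longrightarrow> evn p \<longleftrightarrow> \<not> evn q"
  using A_iff[of q] unfolding nxt_def by simp

text \<open>Above a largest cut point \<open>p\<close>, every sufficiently large number of the
  opposite parity would be admissible; one of \<open>r\<close> and \<open>r + 1\<close> has that
  parity.\<close>

lemma A_unbounded:
  assumes p: "p \<in> A" shows "\<exists>q. q \<in> A \<and> p < q"
proof (rule ccontr)
  assume "\<not> (\<exists>q. q \<in> A \<and> p < q)"
  then have max: "q \<le> p" if "q \<in> A" for q using that by (meson not_le)
  obtain r where r: "dstep p r" using ex_dstep by blast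
  have "r \<le> r + 1" by simp
  then have r': "dstep p (r + 1)" using dstep_mono[OF r order_refl] by blast
  obtain y where y: "dstep p y" "evn p \<longleftrightarrow> \<not> evn y"
  proof (cases "evn p \<longleftrightarrow> evn r")
    case True
    then show ?thesis using that[OF r'] by simp
  next
    case False
    then show ?thesis using that[OF r] by simp
  qed
  have "y \<in> A"
  proof (subst A_iff, intro allI impI conjI)
    fix p' assume p': "p' < y" "p' \<in> A"
    show "dstep p' y" using dstep_mono[OF y(1) max[OF p'(2)] order_refl] .
    assume last: "\<forall>r<y. p' < r \<longrightarrow> r \<notin> A"
    have "\<not> p' < p" using last p dstep_less[OF y(1)] by blast
    then have "p' = p" using max[OF p'(2)] by simp
    then show "evn p' \<longleftrightarrow> \<not> evn y" using y(2) by simp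
  qed
  then have "y \<le> p" by (rule max)
  then show False using dstep_less[OF y(1)] by simp
qed

lemma ex_nxt:
  assumes p: "p \<in> A" shows "\<exists>q. nxt p q"
proof -
  obtain q where "q \<in> A \<and> p < q" using A_unbounded[OF p] by blast
  then have "\<exists>q. (q \<in> A \<and> p < q) \<and> (\<forall>r<q. \<not> (r \<in> A \<and> p < r))"
    by (rule delta0_least[where Q = "\<lambda>q. q \<in> A \<and> p < q", rotated])
      (intro delta0_closure A_Sets)
  then show ?thesis using p unfolding nxt_def by blast
qed

text \<open>The induction runs over points, not over the number of blocks: passing from
  \<open>x\<close> to \<open>x + 1\<close> changes the block only if \<open>x + 1\<close> is its
  right end.\<close>

lemma ex_block: "\<exists>p q. nxt p q \<and> p \<le> x \<and> x < q"
proof -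
  have "\<exists>q. \<exists>p<q. nxt p q \<and> p \<le> x \<and> x < q"
  proof (rule sigma1_induct[where Q = "\<lambda>q x. \<exists>p<q. nxt p q \<and> p \<le> x \<and> x < q"])
    show "delta0 (Suc (Suc 0)) (\<lambda>e. \<exists>p<e 0. nxt p (e 0) \<and> p \<le> e (Suc 0) \<and> e (Suc 0) < e 0)"
      by (intro delta0_closure delta0_nxt)
    obtain q where q: "nxt 0 q" using ex_nxt[OF zero_in_A] by blast
    then have "0 < q" by (simp add: nxt_def)
    then show "\<exists>q. \<exists>p<q. nxt p q \<and> p \<le> 0 \<and> 0 < q" using q by blast
    fix x q assume "\<exists>p<q. nxt p q \<and> p \<le> x \<and> x < q"
    then obtain p where p: "p < q" "nxt p q" "p \<le> x" "x < q" by blast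
    show "\<exists>q. \<exists>p<q. nxt p q \<and> p \<le> x + 1 \<and> x + 1 < q"
    proof (cases "x + 1 = q")
      case True
      obtain r where r: "nxt q r" using ex_nxt[of q] p(2) by (auto simp: nxt_def)
      then have "q < r" by (simp add: nxt_def)
      then show ?thesis using r True by (intro exI[of _ r] exI[of _ q]) simp
    next
      case False
      then have "x + 1 < q" using p(4) Suc_le_iff[of x q] by simp
      moreover have "p \<le> x + 1" using p(3) by (meson less_Suc_iff order_less_imp_le)
      ultimately show ?thesis using p(1,2) by blast
    qed
  qed
  then show ?thesis by blast
qed

lemma A_between: "nxt p q \<Longrightarrow> r \<in> A \<Longrightarrow> p < r \<Longrightarrow> q \<le> r"
  unfolding nxt_def by (meson not_le)

lemma block_unique:
  assumes "nxt p q" "p \<le> x" "x < q" "nxt p' q'" "p' \<le> x" "x < q'"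
  shows "p = p'" "q = q'"
proof -
  have A: "p \<in> A" "q \<in> A" "p' \<in> A" "q' \<in> A" "p < q" "p' < q'"
    using assms(1,4) by (auto simp: nxt_def)
  have "\<not> p < p'" using A_between[OF assms(1) A(3)] assms(3,5) by auto
  moreover have "\<not> p' < p" using A_between[OF assms(4) A(1)] assms(2,6) by auto
  ultimately show p: "p = p'" by simp
  have "q \<le> q'" using A_between[OF assms(1) A(4)] A(6) p by simp
  moreover have "q' \<le> q" using A_between[OF assms(4) A(2)] A(5) p by simp
  ultimately show "q = q'" by simp
qed

lemma nxt_fun: "nxt p q \<Longrightarrow> nxt p q' \<Longrightarrow> q = q'"
  by (rule block_unique(2)[of p q p p]) (auto simp: nxt_def)

text \<open>
  A block \<open>[p, q)\<close> is colored with a \<open>k\<close>-coloring \<open>t\<close> of everything up to the end \<open>r\<close> of the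
  next block, in the palette belonging to the parity of the block. The exceptions
  are the vertices adjacent to the previous block to which \<open>t\<close> gives the shared color \<open>0\<close>. They
  receive the color that the \<open>k\<close>-coloring \<open>s\<close> of the previous block gives to them.
\<close>

definition block :: "M \<Rightarrow> M \<Rightarrow> M \<Rightarrow> M \<Rightarrow> M \<Rightarrow> M \<Rightarrow> bool" where
  "block p q r s t x \<longleftrightarrow>
     nxt p q \<and> nxt q r \<and> p \<le> x \<and> x < q \<and> least_colr q s \<and> least_colr r t"

definition transition :: "M \<Rightarrow> M \<Rightarrow> M \<Rightarrow> bool" where
  "transition p t x \<longleftrightarrow> (\<exists>z<p. pr z x \<in> E) \<and> col t x 0"

definition block_color :: "M \<Rightarrow> M \<Rightarrow> M \<Rightarrow> M \<Rightarrow> M \<Rightarrow> bool" where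
  "block_color p s t x j \<longleftrightarrow>
     transition p t x \<and> (\<exists>i<k. col s x i \<and> palette (\<not> evn p) i j) \<or>
     \<not> transition p t x \<and> (\<exists>i<k. col t x i \<and> palette (evn p) i j)"

text \<open>A single \<open>w\<close> bounds all five witnesses, so that \<open>color\<close> is
  bounded and fits \<open>function_comprehension\<close>.\<close>

definition color :: "M \<Rightarrow> M \<Rightarrow> M \<Rightarrow> bool" where
  "color w x j \<longleftrightarrow> (\<exists>p<w. \<exists>q<w. \<exists>r<w. \<exists>s<w. \<exists>t<w. block p q r s t x \<and> block_color p s t x j)"

lemma delta0_color:
  "tfun d f \<Longrightarrow> tfun d g \<Longrightarrow> tfun d h \<Longrightarrow> delta0 d (\<lambda>e. color (f e) (g e) (h e))"
  unfolding color_def block_def block_color_def transition_def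
  by (intro delta0_closure delta0_nxt delta0_least_colr delta0_col delta0_palette delta0_evn Sets)

lemma col_less: "col s x i \<Longrightarrow> i < k"
  by (simp add: col_def)

lemma ex_block_data: "\<exists>p q r s t. block p q r s t x"
proof -
  obtain p q where pq: "nxt p q" "p \<le> x" "x < q" using ex_block by blast
  obtain r where r: "nxt q r" using ex_nxt[of q] pq(1) by (auto simp: nxt_def)
  obtain s t where "least_colr q s" "least_colr r t" using ex_least_colr by blast
  then show ?thesis using pq r unfolding block_def by blast
qed

text \<open>The left end \<open>p\<close> alone determines the data: the next two cut points are
  unique, and so are the least colorings.\<close>

lemma block_data_unique:
  assumes "block p q r s t x" "block p q' r' s' t' y"
  shows "q = q'" "r = r'" "s = s'" "t = t'"
proof -
  show q: "q = q'" using assms nxt_fun unfolding block_def by blast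
  show r: "r = r'" using assms q nxt_fun[of q r r'] unfolding block_def by simp
  show "s = s'" using assms q least_colr_unique[of q s s'] unfolding block_def by simp
  show "t = t'" using assms r least_colr_unique[of r t t'] unfolding block_def by simp
qed

lemma block_less: "block p q r s t x \<Longrightarrow> x < q \<and> x < r"
  unfolding block_def nxt_def by auto

lemma ex_block_color:
  assumes b: "block p q r s t x" and x: "x \<in> V"
  shows "\<exists>j. block_color p s t x j"
proof -
  have lc: "least_colr q s" "least_colr r t" "x < q" "x < r"
    using b block_less[OF b] by (auto simp: block_def)
  obtain i where i: "col s x i" "i < k" using ex_col[OF lc(1,3) x] col_less by blast
  obtain i' where i': "col t x i'" "i' < k" using ex_col[OF lc(2,4) x] col_less by blast
  obtain j where "palette (\<not> evn p) i j" using ex_palette by blast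
  moreover obtain j' where "palette (evn p) i' j'" using ex_palette by blast
  ultimately show ?thesis unfolding block_color_def using i i' by blast
qed

lemma block_color_unique:
  assumes b: "block p q r s t x" and "block_color p s t x j" "block_color p s t x j'"
  shows "j = j'"
proof -
  have lc: "least_colr q s" "least_colr r t" "x < q" "x < r"
    using b block_less[OF b] by (auto simp: block_def)
  show ?thesis
    using assms(2,3) col_unique[OF lc(1,3)] col_unique[OF lc(2,4)] palette_fun
    unfolding block_color_def by blast
qed

lemma color_unique:
  assumes "color w x j" "color w' x j'" shows "j = j'"
proof -
  obtain p q r s t where b: "block p q r s t x" "block_color p s t x j"
    using assms(1) unfolding color_def by blast
  obtain p' q' r' s' t' where b': "block p' q' r' s' t' x" "block_color p' s' t' x j'"
    using assms(2) unfolding color_def by blast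
  have "p = p'" using b(1) b'(1) block_unique(1)[of p q x p' q'] unfolding block_def by simp
  then have "block p q' r' s' t' x" using b'(1) by simp
  then have "s = s'" "t = t'" by (rule block_data_unique[OF b(1)])+
  then show ?thesis using block_color_unique[OF b] b'(2) \<open>p = p'\<close> by simp
qed

lemma ex_color: "x \<in> V \<Longrightarrow> \<exists>w j. color w x j"
proof -
  assume x: "x \<in> V"
  obtain p q r s t where b: "block p q r s t x" using ex_block_data by blast
  obtain j where j: "block_color p s t x j" using ex_block_color[OF b x] by blast
  define w where "w = max p (max q (max r (max s t))) + 1"
  have "p < w" "q < w" "r < w" "s < w" "t < w" unfolding w_def less_Suc_iff by (simp_all add: le_max_iff_disj)
  then have "color w x j" unfolding color_def using b j by blast
  then show ?thesis by blast
qed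

section \<open>Absence of conflicts\<close>

lemma same_block:
  assumes b: "block p q r s t x" "block p q r s t y" and e: "pr x y \<in> E"
    and c: "block_color p s t x j" "block_color p s t y j"
  shows False
proof -
  have lc: "least_colr q s" "least_colr r t" "x < q" "x < r" "y < q" "y < r"
    using b block_less[OF b(1)] block_less[OF b(2)] by (auto simp: block_def)
  note edge_t = col_edge[OF lc(2,4,6) e]
  show False
  proof (cases "transition p t x"; cases "transition p t y")
    assume "transition p t x" "transition p t y"
    \<comment> \<open>Both vertices have color 0 in the proper coloring \<open>t\<close>.\<close>
    then show False using edge_t unfolding transition_def by blast
  next
    assume x: "transition p t x" and y: "\<not> transition p t y"
    obtain i where i: "i < k" "palette (\<not> evn p) i j"
      using c(1) x unfolding block_color_def by blast
    obtain i' where i': "i' < k" "col t y i'" "palette (evn p) i' j"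
      using c(2) y unfolding block_color_def by blast
    \<comment> \<open>The vertices use different palettes, so the common color is 0. Then
      \<open>y\<close> has color 0 in \<open>t\<close>, and so does the transition vertex
      \<open>x\<close>.\<close>
    have "i' = 0" using palette_disjoint(1)[OF i'(3) i(2) i'(1) i(1)] .
    then show False using i'(2) x edge_t unfolding transition_def by blast
  next
    assume x: "\<not> transition p t x" and y: "transition p t y"
    obtain i where i: "i < k" "col t x i" "palette (evn p) i j"
      using c(1) x unfolding block_color_def by blast
    obtain i' where i': "i' < k" "palette (\<not> evn p) i' j"
      using c(2) y unfolding block_color_def by blast
    have "i = 0" using palette_disjoint(1)[OF i(3) i'(2) i(1) i'(1)] .
    then show False using i(2) y edge_t unfolding transition_def by blast
  next
    assume x: "\<not> transition p t x" and y: "\<not> transition p t y"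
    obtain i where i: "i < k" "col t x i" "palette (evn p) i j"
      using c(1) x unfolding block_color_def by blast
    obtain i' where i': "i' < k" "col t y i'" "palette (evn p) i' j"
      using c(2) y unfolding block_color_def by blast
    have "i = i'" using palette_inj[OF i(3) i'(3) i(1) i'(1)] .
    then show False using i(2) i'(2) edge_t by blast
  qed
qed

lemma adjacent_blocks:
  assumes b: "block p q r s t x" "block q r r' t t' y" and e: "pr x y \<in> E"
    and c: "block_color p s t x j" "block_color q t t' y j"
  shows False
proof -
  have lc: "least_colr r t" "least_colr r' t'" "x < q" "x < r" "q \<le> y" "y < r" "y < r'" "nxt p q"
    using b block_less[OF b(1)] block_less[OF b(2)] by (auto simp: block_def)
  note edge_t = col_edge[OF lc(1,4,6) e]
  have parity: "evn p \<longleftrightarrow> \<not> evn q" using nxt_parity[OF lc(8)] .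
  \<comment> \<open>Otherwise a path \<open>z\<close>, \<open>x\<close>, \<open>y\<close> of length
    two would lead from below \<open>p\<close> to a vertex at or above \<open>q\<close>, against the
    spacing of the cut points.\<close>
  have "\<not> transition p t x"
  proof
    assume "transition p t x"
    then obtain z where "z < p" "pr z x \<in> E" unfolding transition_def by blast
    moreover have "dstep p q" using A_dstep[of p q] lc(8) unfolding nxt_def by simp
    ultimately have "y < q" using dstep_edge2[of p q z x y] e by blast
    then show False using lc(5) by simp
  qed
  then obtain i where i: "i < k" "col t x i" "palette (evn p) i j"
    using c(1) unfolding block_color_def by blast
  show False
  proof (cases "transition q t' y")
    case True
    then obtain i' where i': "i' < k" "col t y i'" "palette (\<not> evn q) i' j"
      using c(2) unfolding block_color_def by blast
    \<comment> \<open>Both colors now come from \<open>t\<close>, in the palette of the first block,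
      and \<open>t\<close> is proper on both vertices.\<close>
    have "i = i'" using palette_inj[OF i(3) _ i(1) i'(1)] i'(3) parity by simp
    then show False using i(2) i'(2) edge_t by blast
  next
    case False
    then obtain i' where i': "i' < k" "col t' y i'" "palette (evn q) i' j"
      using c(2) unfolding block_color_def by blast
    \<comment> \<open>Different palettes meet only in 0; but a vertex of color 0 with the neighbor
      \<open>x\<close> in the previous block is a transition vertex.\<close>
    have "i' = 0" using palette_disjoint(2)[OF i(3) _ i(1) i'(1)] i'(3) parity by simp
    then have "transition q t' y" unfolding transition_def using i'(2) e lc(3) by blast
    then show False using False by contradiction
  qed
qed

text \<open>An edge that starts below \<open>q\<close> ends below \<open>r\<close>, so a later block
  can only be the next one. Its coloring \<open>s'\<close> is then the coloring \<open>t\<close> of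
  the earlier block, both being least for the same bound.\<close>

lemma block_color_edge:
  assumes b: "block p q r s t x" "block p' q' r' s' t' y" and e: "pr x y \<in> E"
    and c: "block_color p s t x j" "block_color p' s' t' y j" and "p \<le> p'"
  shows False
proof (cases "p = p'")
  case True
  have b2: "block p q' r' s' t' y" using b(2) True by simp
  show False using same_block[OF b(1) _ e c(1)] b2 c(2) True block_data_unique[OF b(1) b2] by simp
next
  case False
  then have "p < p'" using \<open>p \<le> p'\<close> by simp
  have A: "p' \<in> A" "q \<in> A" "r \<in> A" "q < r" "nxt p q" "nxt q r" "x < q" "p' \<le> y"
    using b unfolding block_def nxt_def by auto
  have "q \<le> p'" using A_between[OF A(5,1) \<open>p < p'\<close>] .
  have "y < r" using dstep_edge[OF A_dstep[OF A(2-4)] A(7) e] .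
  then have "\<not> q < p'" using A_between[OF A(6,1)] A(8) by auto
  then have q: "p' = q" using \<open>q \<le> p'\<close> by simp
  have "nxt q q'" "least_colr q' s'" using b(2) q unfolding block_def by auto
  moreover have "least_colr r t" using b(1) unfolding block_def by simp
  ultimately have "q' = r" "s' = t"
    using nxt_fun[OF A(6)] least_colr_unique[of r t s'] by auto
  then show False using adjacent_blocks[OF b(1) _ e c(1)] b(2) c(2) q by simp
qed

theorem ex_coloring:
  assumes m: "m + 1 = (1 + 1) * k \<or> k = 0 \<and> m = 0"
  shows "\<exists>C\<in>Sets. is_coloring C V E m"
proof -
  have "\<exists>C\<in>Sets. \<forall>e. e \<in> C \<longleftrightarrow> (\<exists>x j w. e = pr x j \<and> x \<in> V \<and> color w x j)"
    using delta0_color Sets(1) ex_color color_unique by (rule function_comprehension)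
  then obtain C where C: "C \<in> Sets"
    "\<And>e. e \<in> C \<longleftrightarrow> (\<exists>x j w. e = pr x j \<and> x \<in> V \<and> color w x j)" by blast
  have mem: "pr x j \<in> C \<longleftrightarrow> x \<in> V \<and> (\<exists>w. color w x j)" for x j by (simp add: C(2))
  have "is_function C V"
    unfolding is_function_def
  proof (intro conjI ballI allI impI)
    show "\<exists>x u. x \<in> V \<and> e = pr x u" if "e \<in> C" for e using that unfolding C(2) by blast
    show "\<exists>u. pr x u \<in> C" if "x \<in> V" for x unfolding mem using ex_color[OF that] that by blast
    show "u = v" if "pr x u \<in> C \<and> pr x v \<in> C" for x u v
      using that color_unique unfolding mem by blast
  qed
  moreover have "j < m" if j: "pr x j \<in> C" for x j
  proof -
    obtain p s t where "block_color p s t x j" using j unfolding mem color_def by blast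
    then obtain i e where i: "i < k" "palette e i j" unfolding block_color_def by blast
    \<comment> \<open>A color \<open>i\<close> below \<open>k\<close> excludes the case
      \<open>k = 0\<close>.\<close>
    then have "m + 1 = (1 + 1) * k" using m by auto
    then show ?thesis using palette_less[OF i(2,1)] by blast
  qed
  moreover have "pr y u \<notin> C" if e: "pr x y \<in> E" and u: "pr x u \<in> C" for x y u
  proof
    assume v: "pr y u \<in> C"
    obtain p q r s t where b: "block p q r s t x" "block_color p s t x u"
      using u unfolding mem color_def by blast
    obtain p' q' r' s' t' where b': "block p' q' r' s' t' y" "block_color p' s' t' y u"
      using v unfolding mem color_def by blast
    show False
    proof (cases "p \<le> p'")
      case True
      then show False using block_color_edge[OF b(1) b'(1) e b(2) b'(2)] by blast
    next
      case False
      then have "p' \<le> p" by simp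
      \<comment> \<open>Symmetry of the edges allows the two vertices to be exchanged.\<close>
      moreover have "pr y x \<in> E" using edge[OF e] by blast
      ultimately show False using block_color_edge[OF b'(1) b(1) _ b'(2) b(2)] by blast
    qed
  qed
  ultimately have "is_coloring C V E m" unfolding is_coloring_def by simp
  then show ?thesis using C(1) by blast
qed

end


section \<open>Evaluating the statement in the model\<close>

lemma eval_pair [simp]: "eval e (pair s t) = pr (eval e s) (eval e t)"
  by (simp add: pair_def pr_def)

lemma sat_graph [simp]: "satM e \<rho> (graph X Y) \<longleftrightarrow> is_graph (\<rho> X) (\<rho> Y)"
  unfolding graph_def is_graph_def by (simp add: Ball_def conj_ac)

lemma sat_function_on [simp]: "satM e \<rho> (function_on X Y) \<longleftrightarrow> is_function (\<rho> X) (\<rho> Y)"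
  unfolding function_on_def is_function_def by (simp add: Ball_def imp_conjL)

lemma sat_coloring [simp]:
  "satM e \<rho> (coloring C X Y t) \<longleftrightarrow> is_coloring (\<rho> C) (\<rho> X) (\<rho> Y) (eval e t)"
  unfolding coloring_def is_coloring_def by simp

lemma sat_subgraph [simp]:
  "satM e \<rho> (subgraph X' Y' X Y) \<longleftrightarrow> is_graph (\<rho> X') (\<rho> Y') \<and> \<rho> X' \<subseteq> \<rho> X \<and> \<rho> Y' \<subseteq> \<rho> Y"
  unfolding subgraph_def subset_def by (simp add: subset_iff)

lemma sat_chromatic [simp]:
  "satM e \<rho> (chromatic X Y t) \<longleftrightarrow> (\<exists>C\<in>Sets. is_coloring C (\<rho> X) (\<rho> Y) (eval e t))"
  unfolding chromatic_def by simp

lemma sat_locally_chromatic [simp]: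
  "satM e \<rho> (locally_chromatic X Y t) \<longleftrightarrow>
     (\<forall>V\<in>Sets. \<forall>E\<in>Sets. is_graph V E \<and> V \<subseteq> \<rho> X \<and> E \<subseteq> \<rho> Y \<and> (\<exists>b. \<forall>x. x \<in> V \<longrightarrow> x < b) \<longrightarrow>
       (\<exists>C\<in>Sets. is_coloring C V E (eval e t)))"
  unfolding locally_chromatic_def finite_set_def by simp

lemma sat_bounded_graph [simp]:
  "satM e \<rho> (bounded_graph X Y) \<longleftrightarrow>
     (\<exists>F\<in>Sets. is_function F (\<rho> X) \<and> (\<forall>x y. x \<in> \<rho> X \<and> y \<in> \<rho> X \<and> pr x y \<in> \<rho> Y \<longrightarrow>
        (\<forall>u. pr x u \<in> F \<longrightarrow> y \<le> u)))"
  unfolding bounded_graph_def by (simp add: le_less imp_conjL)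

lemma sat_twice_minus_one [simp]:
  "satM e \<rho> (twice_minus_one s t) \<longleftrightarrow>
     eval e s + 1 = (1 + 1) * eval e t \<or> eval e t = 0 \<and> eval e s = 0"
  unfolding twice_minus_one_def by auto

lemma (in rca) chromatic_2k_minus_1:
  assumes S: "V \<in> Sets" "E \<in> Sets" and graph: "is_graph V E"
    and bounded: "\<exists>F\<in>Sets. is_function F V \<and> (\<forall>x y. x \<in> V \<and> y \<in> V \<and> pr x y \<in> E \<longrightarrow>
        (\<forall>u. pr x u \<in> F \<longrightarrow> y \<le> u))"
    and local: "\<forall>V'\<in>Sets. \<forall>E'\<in>Sets. is_graph V' E' \<and> V' \<subseteq> V \<and> E' \<subseteq> E \<and> (\<exists>b. \<forall>x. x \<in> V' \<longrightarrow> x < b) \<longrightarrow>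
       (\<exists>C\<in>Sets. is_coloring C V' E' k)"
    and m: "m + 1 = (1 + 1) * k \<or> k = 0 \<and> m = 0"
  shows "\<exists>C\<in>Sets. is_coloring C V E m"
proof -
  obtain F where F: "F \<in> Sets" "is_function F V"
    "\<And>x y u. x \<in> V \<Longrightarrow> y \<in> V \<Longrightarrow> pr x y \<in> E \<Longrightarrow> pr x u \<in> F \<Longrightarrow> y \<le> u"
    using bounded by blast
  interpret bgraph V E F k
  proof
    show "\<exists>C\<in>Sets. is_coloring C V' E' k"
      if "V' \<in> Sets" "E' \<in> Sets" "is_graph V' E'" "V' \<subseteq> V" "E' \<subseteq> E" "\<forall>x\<in>V'. x < b" for V' E' b
      using local[rule_format, OF that(1,2)] that(3-6) by blast
  qed (fact S graph F)+
  obtain A where "is_cuts A" using ex_cuts by blast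
  then interpret cuts V E F k A by unfold_locales
  show ?thesis using m by (rule ex_coloring)
qed

lemma (in rca) sat_target: "satM base sbase target"
  unfolding target_def sat.simps(6,7)
proof (intro allI ballI, subst sat.simps(5), intro impI, subst sat.simps(6), intro allI,
    subst sat.simps(5), intro impI)
  fix k m V E
  assume VE: "V \<in> Sets" "E \<in> Sets"
  let ?e = "case_nat k base" and ?\<rho> = "case_nat E (case_nat V sbase)"
  assume "satM ?e ?\<rho> (graph 1 0 \<^bold>\<and> bounded_graph 1 0 \<^bold>\<and> locally_chromatic 1 0 (Var 0))"
    and "satM (case_nat m ?e) ?\<rho> (twice_minus_one (Var 0) (Var 1))"
  then show "satM (case_nat m ?e) ?\<rho> (chromatic 1 0 (Var 0))"
    using chromatic_2k_minus_1[OF VE, of k m]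
    unfolding sat_connectives(2) sat_graph sat_bounded_graph sat_locally_chromatic
      sat_twice_minus_one sat_chromatic
    by simp
qed

theorem theorem11:
  "RCA0; [] \<turnstile>
     All (AllS (AllS (
       graph 1 0 \<^bold>\<and> bounded_graph 1 0 \<^bold>\<and> locally_chromatic 1 0 (Var 0) \<^bold>\<longrightarrow>
       All (twice_minus_one (Var 0) (Var 1) \<^bold>\<longrightarrow> chromatic 1 0 (Var 0)))))"
proof (rule ccontr)
  assume "\<not> ?thesis"
  then have not: "\<not> RCA0; [] \<turnstile> target" by (simp only: target_def not_False_eq_True)
  \<comment> \<open>Unprovability makes \<open>canon\<close> a Henkin set for all of
    \<open>RCA0\<close> that contains the negation of \<open>target\<close>, so comprehension
    becomes available in the model.\<close>
  interpret rca by unfold_locales (rule canon_RCA0(1)[OF not])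
  have "satM base sbase target \<longleftrightarrow> target \<in> canon"
    using truth[of Var "\<lambda>i. i" target] by (simp add: base_def[abs_def])
  then show False using sat_target canon_RCA0(2)[OF not] by simp
qed

end
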